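(* Let $\mathcal H=\bigcup_{\ell\in\mathcal L}\mathcal H_\ell$ be the non-uniform inhomogeneous Erdős–Rényi hypergraph on $\mathcal V=[N]$ associated with symmetric probability tensors $\{Q^{(\ell)}\}_{\ell\in\mathcal L}$, with adjacency matrix $A$ (see context). Let $d_v$ be the number of hyperedges containing $v$, $\overline d=N^{-1}\sum_{v}d_v$, $\rho_N=\max_v\mathbb E[d_v]$, and $\mathcal D_{\max}=\sum_{\ell\in\mathcal L}\binom{N-1}{\ell-1}\max_{i_1,\dots,i_\ell}Q^{(\ell)}_{i_1,\dots,i_\ell}$. Consider the inequality $$\|A_{\mathcal J}-\mathbb EA_{\mathcal J}\|\le C\sqrt{\mathcal D_{\max}},\qquad(\ast)$$ where $C=10L_{\max}^2+2\beta$ with $\beta=\beta_0\sqrt{\beta_1}+L_{\max}$, $\beta_1=L_{\max}$ and $\beta_0=16+32L_{\max}(1+e^2)+1792(1+e^{-2})L_{\max}^2$. (1) Let $\mathcal J_1$ be the vertex set obtained from $\mathcal V$ by removing the $\lfloor N\exp(-\overline d)\rfloor$ vertices having the largest $d_v$. If $\rho_N\gtrsim\log N$, there is a constant $c>0$ such that $(\ast)$ holds for $\mathcal J=\mathcal J_1$ with probability at least $1-2(e/2)^{-N}-2N^{-c}$. (2) Let $\mathcal J_2=\{v\in\mathcal V:d_v\le20L_{\max}\mathcal D_{\max}\}$. Then $(\ast)$ holds for $\mathcal J=\mathcal J_2$ with probability at least $1-2(e/2)^{-N}-N^{-10}$.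
   Context: $\mathcal L$ is a finite set of integers $\ge2$ with maximum element $L_{\max}$. For each $\ell\in\mathcal L$, $Q^{(\ell)}$ is a symmetric order-$\ell$ tensor with entries $Q^{(\ell)}_{i_1,\dots,i_\ell}\in[0,1]$, $i_1,\dots,i_\ell\in[N]$. All hyperedges are independent: for each $\ell\in\mathcal L$ and each $\ell$-subset $e=\{i_1,\dots,i_\ell\}$ of $[N]$, $e$ is a hyperedge ($A^{(\ell)}_e=1$, otherwise $0$) with probability $Q^{(\ell)}_{i_1,\dots,i_\ell}$. The adjacency matrix is $A_{ij}=\mathbf 1\{i\ne j\}\sum_{\ell\in\mathcal L}\sum_{e\supset\{i,j\},|e|=\ell}A^{(\ell)}_e$. For a matrix $M\in\mathbb R^{N\times N}$ and $\mathcal J\subset[N]$, $M_{\mathcal J}$ is the $N\times N$ matrix with entries $\mathbf 1\{i,j\in\mathcal J\}M_{ij}$, and $\mathbb EA_{\mathcal J}$ means $(\mathbb EA)_{\mathcal J}$. $\|\cdot\|$ is the spectral norm. $\rho_N\gtrsim\log N$ means $\rho_N\ge c'\log N$ for some constant $c'>0$; asymptotic statements are for sufficiently large $N$. *)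

theory Defs
  imports "HOL-Probability.Probability"
begin

section \<open>Probability tensors and the random hypergraph\<close>

text \<open>
  The vertex set is \<open>{1..N}\<close>.  A family of tensors is a function \<open>Q\<close> such that
  \<open>Q l [i\<^sub>1, \<dots>, i\<^sub>l]\<close> is the entry of the order-\<open>l\<close> tensor at the multi-index
  \<open>(i\<^sub>1, \<dots>, i\<^sub>l)\<close>; repeated indices are allowed.
\<close>

definition multi_indices :: "nat \<Rightarrow> nat \<Rightarrow> nat list set" where
  "multi_indices N l = {xs. length xs = l \<and> set xs \<subseteq> {1..N}}"

definition symmetric_prob_tensors :: "nat set \<Rightarrow> nat \<Rightarrow> (nat \<Rightarrow> nat list \<Rightarrow> real) \<Rightarrow> bool" where
  "symmetric_prob_tensors L N Q \<longleftrightarrow>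
     (\<forall>l\<in>L. \<forall>xs\<in>multi_indices N l.
        0 \<le> Q l xs \<and> Q l xs \<le> 1 \<and>
        (\<forall>ys\<in>multi_indices N l. mset ys = mset xs \<longrightarrow> Q l ys = Q l xs))"

definition possible_edges :: "nat \<Rightarrow> nat \<Rightarrow> nat set set" where
  "possible_edges N l = {e. e \<subseteq> {1..N} \<and> card e = l}"

text \<open>By symmetry of the tensors the order in which the vertices of an edge are listed is
  irrelevant; the increasing order is used.\<close>

definition edge_prob :: "(nat \<Rightarrow> nat list \<Rightarrow> real) \<Rightarrow> nat set \<Rightarrow> real" where
  "edge_prob Q e = Q (card e) (sorted_list_of_set e)"

text \<open>An outcome \<open>H\<close> is the indicator of the set of hyperedges. An edge determines its order
  \<open>l = card e\<close>, so the indicators for the different orders form a single function.\<close>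

definition ER_hypergraph ::
    "nat set \<Rightarrow> nat \<Rightarrow> (nat \<Rightarrow> nat list \<Rightarrow> real) \<Rightarrow> (nat set \<Rightarrow> bool) pmf" where
  "ER_hypergraph L N Q =
     Pi_pmf (\<Union>l\<in>L. possible_edges N l) False (\<lambda>e. bernoulli_pmf (edge_prob Q e))"


section \<open>Adjacency matrix and degrees\<close>

text \<open>\<open>N \<times> N\<close> matrices are functions \<open>nat \<Rightarrow> nat \<Rightarrow> real\<close>, of which only the
  entries with indices in \<open>{1..N}\<close> matter.\<close>

definition adjacency :: "nat set \<Rightarrow> nat \<Rightarrow> (nat set \<Rightarrow> bool) \<Rightarrow> nat \<Rightarrow> nat \<Rightarrow> real" where
  "adjacency L N H i j =
     of_bool (i \<noteq> j) * (\<Sum>l\<in>L. \<Sum>e\<in>{e \<in> possible_edges N l. {i, j} \<subseteq> e}. of_bool (H e))"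

definition expected_adjacency ::
    "nat set \<Rightarrow> nat \<Rightarrow> (nat \<Rightarrow> nat list \<Rightarrow> real) \<Rightarrow> nat \<Rightarrow> nat \<Rightarrow> real" where
  "expected_adjacency L N Q i j =
     measure_pmf.expectation (ER_hypergraph L N Q) (\<lambda>H. adjacency L N H i j)"

definition restrict_matrix :: "nat set \<Rightarrow> (nat \<Rightarrow> nat \<Rightarrow> real) \<Rightarrow> nat \<Rightarrow> nat \<Rightarrow> real" where
  "restrict_matrix J M i j = of_bool (i \<in> J \<and> j \<in> J) * M i j"

definition spectral_norm :: "nat \<Rightarrow> (nat \<Rightarrow> nat \<Rightarrow> real) \<Rightarrow> real" where
  "spectral_norm N M =
     (SUP x\<in>{x. L2_set x {1..N} \<le> 1}. L2_set (\<lambda>i. \<Sum>j\<in>{1..N}. M i j * x j) {1..N})"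

definition degree :: "nat set \<Rightarrow> nat \<Rightarrow> (nat set \<Rightarrow> bool) \<Rightarrow> nat \<Rightarrow> nat" where
  "degree L N H v = card {e \<in> (\<Union>l\<in>L. possible_edges N l). H e \<and> v \<in> e}"

definition average_degree :: "nat set \<Rightarrow> nat \<Rightarrow> (nat set \<Rightarrow> bool) \<Rightarrow> real" where
  "average_degree L N H = (\<Sum>v\<in>{1..N}. real (degree L N H v)) / real N"

definition max_expected_degree :: "nat set \<Rightarrow> nat \<Rightarrow> (nat \<Rightarrow> nat list \<Rightarrow> real) \<Rightarrow> real" where
  "max_expected_degree L N Q =
     Max ((\<lambda>v. measure_pmf.expectation (ER_hypergraph L N Q) (\<lambda>H. real (degree L N H v))) ` {1..N})"

definition D_max :: "nat set \<Rightarrow> nat \<Rightarrow> (nat \<Rightarrow> nat list \<Rightarrow> real) \<Rightarrow> real" where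
  "D_max L N Q = (\<Sum>l\<in>L. real ((N - 1) choose (l - 1)) * Max (Q l ` multi_indices N l))"


section \<open>The two regularized vertex sets and the concentration inequality\<close>

text \<open>Ties between degrees can make the set of \<open>k\<close> vertices of largest degree non-unique:
  the following predicate holds for every set arising from some way of breaking them.\<close>

definition top_degree_removed :: "nat set \<Rightarrow> nat \<Rightarrow> (nat set \<Rightarrow> bool) \<Rightarrow> nat set \<Rightarrow> bool" where
  "top_degree_removed L N H J \<longleftrightarrow>
     J \<subseteq> {1..N} \<and>
     card ({1..N} - J) = nat \<lfloor>real N * exp (- average_degree L N H)\<rfloor> \<and>
     (\<forall>u\<in>{1..N} - J. \<forall>v\<in>J. degree L N H v \<le> degree L N H u)"

definition bounded_degree_vertices ::
    "nat set \<Rightarrow> nat \<Rightarrow> (nat \<Rightarrow> nat list \<Rightarrow> real) \<Rightarrow> (nat set \<Rightarrow> bool) \<Rightarrow> nat set" where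
  "bounded_degree_vertices L N Q H =
     {v \<in> {1..N}. real (degree L N H v) \<le> 20 * real (Max L) * D_max L N Q}"

definition beta0 :: "nat set \<Rightarrow> real" where
  "beta0 L = 16 + 32 * real (Max L) * (1 + (exp 1)\<^sup>2)
                + 1792 * (1 + 1 / (exp 1)\<^sup>2) * (real (Max L))\<^sup>2"

definition beta1 :: "nat set \<Rightarrow> real" where
  "beta1 L = real (Max L)"

definition beta :: "nat set \<Rightarrow> real" where
  "beta L = beta0 L * sqrt (beta1 L) + real (Max L)"

definition conc_const :: "nat set \<Rightarrow> real" where
  "conc_const L = 10 * (real (Max L))\<^sup>2 + 2 * beta L"

definition concentrates ::
    "nat set \<Rightarrow> nat \<Rightarrow> (nat \<Rightarrow> nat list \<Rightarrow> real) \<Rightarrow> (nat set \<Rightarrow> bool) \<Rightarrow> nat set \<Rightarrow> bool" where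
  "concentrates L N Q H J \<longleftrightarrow>
     spectral_norm N (\<lambda>i j. restrict_matrix J (adjacency L N H) i j
                          - restrict_matrix J (expected_adjacency L N Q) i j)
       \<le> conc_const L * sqrt (D_max L N Q)"

end

theory Submission
  imports Defs
begin

text \<open>
  The quadratic form of the centred adjacency matrix is discretized over a grid net that is closed
  under restricting vectors to a vertex set, so no union bound over the removed vertices is needed.
  For a pair of net vectors \<open>x, y\<close>, the light index pairs, those with
  \<open>|x\<^sub>i y\<^sub>j| \<le> sqrt D / N\<close>, are controlled by a Bernstein inequality and a union bound over
  the net.  On the heavy pairs the expectation is negligible; the adjacency part is split into
  dyadic levels of \<open>x\<close> and \<open>y\<close> and bounded using the degrees of the retained
  vertices and a discrepancy estimate for the number of edges between two vertex sets, which holds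
  outside an event of probability \<open>N powr (- 10)\<close>.  For the first part, a Markov bound
  shows that fewer than \<open>N exp (- 3 D)\<close> vertices have degree above \<open>20 Max L D\<close>
  while the average degree is below \<open>3 D\<close>, so all of them are among the removed vertices.
\<close>

section \<open>Sums of independent Bernoulli variables\<close>

text \<open>The constant \<open>C\<close> and both probabilities are prescribed, so every numerical
  choice must fit them. Passing from the net to the norm doubles the bound, so the light pairs cost
  \<open>20 * m^2\<close>, with \<open>m = Max L\<close>, instead of the \<open>10 * m^2\<close>
  displayed in \<open>C\<close>; the excess is paid from slack in \<open>beta\<close>. Matrix
  entries that share a hyperedge are dependent. The independent objects are the hyperedges, and one
  of them meets at most \<open>m^2\<close> ordered pairs, which explains the powers of
  \<open>m\<close>. A union bound over an exponentially large net demands tails of order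
  \<open>exp (- c N)\<close>. At the corresponding exponential rate a hyperedge through a heavy pair
  may have too large a weight, so heavy pairs are treated through vertex subsets, where failure
  probabilities are only polynomial in \<open>N\<close>. The danger there is a logarithmic loss in
  the sum over level pairs; it is avoided by letting the boundary between the mean regime and the
  entropy regime vary with the ratio of the levels. In the second part \<open>D\<close> may be
  arbitrarily small and \<open>N\<close> is any positive number, so no step may assume that
  \<open>D\<close> is large.\<close>

lemma exp_le_one_plus_square:
  fixes x :: real
  assumes "x \<le> 1"
  shows "exp x \<le> 1 + x + x\<^sup>2"
proof (cases "x \<ge> 0")
  case True
  then show ?thesis using assms exp_bound by blast
next
  case False
  define y where "y = - x"
  have y: "y > 0" using False y_def by simp
  \<comment> \<open>The claim for \<open>- y\<close> amounts to
    \<open>1 \<le> (1 - y + y^2) * exp y\<close>, and the quadratic Taylor polynomial of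
    \<open>exp y\<close> already suffices.\<close>
  have "1 \<le> (1 - y + y\<^sup>2) * (1 + y + y\<^sup>2 / 2)"
  proof -
    have "(1 - y + y\<^sup>2) * (1 + y + y\<^sup>2 / 2) = 1 + y\<^sup>2/2 + y^3/2 + y^4/2"
      by (simp add: field_simps power2_eq_square power3_eq_cube power4_eq_xxxx)
    then show ?thesis using y by simp
  qed
  also have "\<dots> \<le> (1 - y + y\<^sup>2) * exp y"
  proof (rule mult_left_mono)
    show "1 + y + y\<^sup>2 / 2 \<le> exp y" using y by (intro exp_lower_Taylor_quadratic) simp
    show "0 \<le> 1 - y + y\<^sup>2" using zero_le_power2[of "y - 1 / 2"] by (simp add: power2_eq_square algebra_simps)
  qed
  finally show ?thesis unfolding y_def by (simp add: exp_minus field_simps)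
qed

text \<open>Finite support makes every real function of the hypergraph integrable, which settles the
  integrability obligations below.\<close>

lemma finite_set_pmf_Pi_bernoulli:
  "finite E \<Longrightarrow> finite (set_pmf (Pi_pmf E False (\<lambda>e. bernoulli_pmf (p e))))"
proof -
  assume "finite E"
  then have "set_pmf (Pi_pmf E False (\<lambda>e. bernoulli_pmf (p e))) \<subseteq> {f. \<forall>x. x \<notin> E \<longrightarrow> f x = False}"
    by (rule set_Pi_pmf_subset)
  also have "\<dots> \<subseteq> (\<lambda>S x. x \<in> S) ` Pow E" 
    by (auto simp: image_iff intro!: bexI[of _ "Collect _"])
  finally show ?thesis using \<open>finite E\<close> finite_subset by blast
qed

text \<open>Peeling off one coordinate of the product measure. Independence of the hyperedges enters
  only here; the tail bounds follow from it, and the rest uses expectations and union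
  bounds.\<close>

lemma bernoulli_mgf:
  assumes "finite E" "\<And>e. e \<in> E \<Longrightarrow> 0 \<le> p e \<and> p e \<le> 1"
  shows "measure_pmf.expectation (Pi_pmf E False (\<lambda>e. bernoulli_pmf (p e)))
           (\<lambda>H. exp (\<Sum>e\<in>E. c e * of_bool (H e))) = (\<Prod>e\<in>E. 1 + p e * (exp (c e) - 1))"
  using assms
proof (induction E)
  case empty
  then show ?case by simp
next
  case (insert x E)
  let ?P = "Pi_pmf E False (\<lambda>e. bernoulli_pmf (p e))"
  have p: "0 \<le> p x" "p x \<le> 1" using insert.prems by auto
  have eq: "exp (\<Sum>e\<in>insert x E. c e * of_bool ((f(x := y)) e)) =
     exp (c x * of_bool y) * exp (\<Sum>e\<in>E. c e * of_bool (f e))" for f y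
  proof -
    have "(\<Sum>e\<in>E. c e * of_bool ((f(x := y)) e)) = (\<Sum>e\<in>E. c e * of_bool (f e))"
      using insert.hyps by (intro sum.cong) auto
    then show ?thesis using insert.hyps by (simp add: exp_add del: sum_mult_of_bool_eq)
  qed
  have "measure_pmf.expectation (Pi_pmf (insert x E) False (\<lambda>e. bernoulli_pmf (p e)))
           (\<lambda>H. exp (\<Sum>e\<in>insert x E. c e * of_bool (H e))) =
     (\<Sum>y\<in>UNIV. pmf (bernoulli_pmf (p x)) y * measure_pmf.expectation (map_pmf (\<lambda>f. f(x := y)) ?P) 
        (\<lambda>H. exp (\<Sum>e\<in>insert x E. c e * of_bool (H e))))"
    using insert.hyps finite_set_pmf_Pi_bernoulli[of E p]
    by (subst Pi_pmf_insert') (auto simp: map_pmf_def[symmetric] pmf_expectation_bind[of UNIV])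
  also have "\<dots> = (\<Sum>y\<in>UNIV. pmf (bernoulli_pmf (p x)) y * (exp (c x * of_bool y) * 
        measure_pmf.expectation ?P (\<lambda>f. exp (\<Sum>e\<in>E. c e * of_bool (f e)))))"
    unfolding integral_map_pmf eq by simp
  also have "\<dots> = (1 + p x * (exp (c x) - 1)) * (\<Prod>e\<in>E. 1 + p e * (exp (c e) - 1))"
    using p insert by (simp add: UNIV_bool algebra_simps)
  finally show ?case using insert.hyps by simp
qed

lemma bernoulli_expectation:
  assumes "finite E" "e \<in> E" "0 \<le> p e" "p e \<le> 1"
  shows "measure_pmf.expectation (Pi_pmf E False (\<lambda>e. bernoulli_pmf (p e))) (\<lambda>H. of_bool (H e)) = p e"
proof -
  have "p e = measure_pmf.expectation (map_pmf (\<lambda>H. H e) (Pi_pmf E False (\<lambda>e. bernoulli_pmf (p e)))) of_bool"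
    using assms by (subst Pi_pmf_component) simp_all
  then show ?thesis by simp
qed

text \<open>The exponential rate is absorbed into the coefficients \<open>c\<close>, of either sign,
  so that the Bernstein bound, the multiplicative upper tail and the degree bounds are all
  instances. Each factor is bounded by \<open>1 + u \<le> exp u\<close>.\<close>

lemma bernoulli_chernoff:
  assumes "finite E" "\<And>e. e \<in> E \<Longrightarrow> 0 \<le> p e \<and> p e \<le> 1"
  shows "measure_pmf.prob (Pi_pmf E False (\<lambda>e. bernoulli_pmf (p e)))
           {H. x \<le> (\<Sum>e\<in>E. c e * of_bool (H e))}
         \<le> exp ((\<Sum>e\<in>E. p e * (exp (c e) - 1)) - x)"
proof -
  let ?P = "Pi_pmf E False (\<lambda>e. bernoulli_pmf (p e))"
  let ?X = "\<lambda>H. exp (\<Sum>e\<in>E. c e * of_bool (H e))"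
  have "measure_pmf.prob ?P {H. x \<le> (\<Sum>e\<in>E. c e * of_bool (H e))} =
        measure_pmf.prob ?P {H \<in> space (measure_pmf ?P). exp x \<le> ?X H}"
    by simp
  also have "\<dots> \<le> measure_pmf.expectation ?P ?X / exp x"
    by (rule integral_Markov_inequality_measure[of _ _ "UNIV"])
       (use assms finite_set_pmf_Pi_bernoulli in \<open>auto intro!: integrable_measure_pmf_finite\<close>)
  also have "\<dots> = (\<Prod>e\<in>E. 1 + p e * (exp (c e) - 1)) / exp x"
    using bernoulli_mgf[OF assms] by simp
  also have "\<dots> \<le> (\<Prod>e\<in>E. exp (p e * (exp (c e) - 1))) / exp x"
  proof (intro divide_right_mono prod_mono conjI)
    fix e assume "e \<in> E"
    then have "0 \<le> p e" "p e \<le> 1" using assms(2) by auto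
    then have "0 \<le> (1 - p e) + p e * exp (c e)" by (intro add_nonneg_nonneg) auto
    then show "0 \<le> 1 + p e * (exp (c e) - 1)" by (simp add: algebra_simps)
  qed auto
  also have "\<dots> = exp ((\<Sum>e\<in>E. p e * (exp (c e) - 1)) - x)"
    using assms(1) by (simp add: exp_sum exp_diff)
  finally show ?thesis .
qed


section \<open>Heavy pairs\<close>

text \<open>The terms are dominated by the series of ratio \<open>1 / sqrt 2\<close> descending from
  the largest one, and \<open>2 + sqrt 2 < 4\<close>. \<open>P\<close> may have gaps, because each
  \<open>p\<close> is injected into the exponents by its distance to \<open>Max P\<close>. Half
  powers occur because the level bounds contain square roots.\<close>

lemma geometric_sum_sqrt2_le:
  fixes P :: "int set" and x M :: real
  assumes "finite P" "0 \<le> M" "\<And>p. p \<in> P \<Longrightarrow> x * 2 powr (of_int p / 2) \<le> M" "0 \<le> x"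
  shows "(\<Sum>p\<in>P. x * 2 powr (of_int p / 2)) \<le> 4 * M"
proof (cases "P = {}")
  case False
  define m where "m = Max P"
  define r :: real where "r = 2 powr (- 1 / 2)"
  have m: "m \<in> P" "\<And>p. p \<in> P \<Longrightarrow> p \<le> m" using assms(1) False by (auto simp: m_def)
  have r: "0 < r" "r \<le> 3 / 4"
  proof -
    have "r\<^sup>2 = 1 / 2" 
      unfolding r_def power2_eq_square powr_add[symmetric] by (simp add: powr_minus)
    also have "\<dots> \<le> (3 / 4)\<^sup>2" by (simp add: power2_eq_square)
    finally show "r \<le> 3 / 4" by (rule power2_le_imp_le) simp
  qed (simp add: r_def)
  have eq: "2 powr (of_int p / 2) = 2 powr (of_int m / 2) * r ^ nat (m - p)" if "p \<in> P" for p
  proof -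
    have "r ^ nat (m - p) = 2 powr - ((of_int m - of_int p) / 2)"
      using m(2)[OF that] by (simp add: r_def powr_power)
    then show ?thesis by (simp add: powr_add[symmetric] field_simps)
  qed
  define n where "n = Suc (Max ((\<lambda>p. nat (m - p)) ` P))"
  have sub: "(\<lambda>p. nat (m - p)) ` P \<subseteq> {..<n}"
    using assms(1) unfolding n_def by (auto simp: less_Suc_eq_le)
  have inj: "inj_on (\<lambda>p. nat (m - p)) P"
  proof (rule inj_onI)
    fix p q assume "p \<in> P" "q \<in> P" "nat (m - p) = nat (m - q)"
    then show "p = q" using m(2)[of p] m(2)[of q] by linarith
  qed
  have "(\<Sum>p\<in>P. x * 2 powr (of_int p / 2)) = (\<Sum>p\<in>P. (x * 2 powr (of_int m / 2)) * r ^ nat (m - p))"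
    using eq by (intro sum.cong) auto
  also have "\<dots> = (x * 2 powr (of_int m / 2)) * (\<Sum>i\<in>(\<lambda>p. nat (m - p)) ` P. r ^ i)"
    by (simp add: sum.reindex[OF inj] sum_distrib_left)
  also have "\<dots> \<le> (x * 2 powr (of_int m / 2)) * (\<Sum>i<n. r ^ i)"
    using r assms(4) sub by (intro mult_left_mono sum_mono2) auto
  also have "\<dots> \<le> (x * 2 powr (of_int m / 2)) * 4"
  proof (rule mult_left_mono)
    have "(\<Sum>i<n. r ^ i) = (1 - r ^ n) / (1 - r)" using r by (simp add: sum_gp_strict)
    also have "\<dots> \<le> 1 / (1 / 4)" using r by (intro frac_le) auto
    finally show "(\<Sum>i<n. r ^ i) \<le> 4" by simp
  qed (use assms(4) in simp)
  also have "\<dots> \<le> 4 * M" using assms(3)[OF m(1)] by simp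
  finally show ?thesis .
qed (use assms in auto)

lemma geometric_sum_sqrt2_decreasing_le:
  fixes P :: "int set" and x M :: real
  assumes "finite P" "0 \<le> M" "\<And>p. p \<in> P \<Longrightarrow> x * 2 powr (- of_int p / 2) \<le> M" "0 \<le> x"
  shows "(\<Sum>p\<in>P. x * 2 powr (- of_int p / 2)) \<le> 4 * M"
proof -
  have "(\<Sum>p\<in>P. x * 2 powr (- of_int p / 2)) = (\<Sum>p\<in>uminus ` P. x * 2 powr (of_int p / 2))"
    by (subst sum.reindex) auto
  also have "\<dots> \<le> 4 * M" using assms by (intro geometric_sum_sqrt2_le) auto
  finally show ?thesis .
qed

text \<open>Here \<open>s\<close> and \<open>k\<close> are the sizes of two levels with values
  \<alpha> and \<beta>, and \<open>e\<close> counts the edges between them. If \<open>e\<close> is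
  at most a multiple \<open>R\<close> of the mean bound, it is estimated directly; otherwise
  \<open>disc\<close> pays for it by the entropy of the set of size \<open>k\<close>. The two
  summands are these two regimes: apart from the mass factors, the first falls like
  \<open>\<beta> powr (-1/2)\<close> at fixed \<alpha> and the second grows like
  \<open>\<alpha> powr (1/2)\<close> at fixed \<beta>.\<close>

lemma heavy_level_bound:
  fixes \<alpha> \<beta> N D s k e m \<kappa> :: real
  assumes pos: "0 < \<alpha>" "0 < \<beta>" "0 < D" "0 < m" "0 \<le> \<kappa>" "0 < s" "0 < k" "k \<le> N" "0 \<le> e"
    and t: "k * \<beta>\<^sup>2 \<le> 1"
    and heavy: "sqrt D / (4 * N) \<le> \<alpha> * \<beta>"
    and w: "\<alpha> \<le> sqrt D * \<beta>"
    and disc: "e * ln (e / (exp 1 * (m * s * k * D / N))) \<le> \<kappa> * (k * ln (exp 1 * N / k))"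
  shows "\<alpha> * \<beta> * e \<le> sqrt D * (2 * exp (5 / 2) * m * (s * \<alpha>\<^sup>2) * sqrt (sqrt D / (N * \<alpha> * \<beta>))
           + 2 * \<kappa> * (k * \<beta>\<^sup>2) * sqrt (\<alpha> / (sqrt D * \<beta>)))"
proof -
  define G where "G = sqrt D"
  define v where "v = G / (N * \<alpha> * \<beta>)"
  define w where "w = \<alpha> / (G * \<beta>)"
  define y where "y = sqrt w"
  define t where "t = k * \<beta>\<^sup>2"
  define l where "l = ln (exp 1 * N / k)"
  define \<mu> where "\<mu> = m * s * k * D / N"
  have N: "0 < N" using pos by linarith
  have G: "0 < G" "D = G\<^sup>2" using pos by (simp_all add: G_def)
  have v: "0 < v" "v \<le> 4"
    using heavy pos G N by (simp_all add: v_def G_def[symmetric] field_simps)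
  have w: "0 < w" "w \<le> 1"
    using w pos G by (simp_all add: w_def G_def[symmetric] field_simps)
  have y: "0 < y" "y \<le> 1" "y\<^sup>2 = w" using w by (simp_all add: y_def)
  have t: "0 < t" "t \<le> 1" using assms by (simp_all add: t_def)
  have \<mu>: "0 < \<mu>" using pos N by (simp add: \<mu>_def)
  \<comment> \<open>The fraction \<open>k / N\<close> splits into the heaviness
    \<open>v \<le> 4\<close>, the level ratio \<open>w \<le> 1\<close> and the mass
    \<open>t \<le> 1\<close>, so the entropy \<open>l\<close> is a sum of logarithms that can be
    controlled one by one.\<close>
  have kN: "k / N = v * w * t"
    using pos G N by (simp add: v_def w_def t_def field_simps power2_eq_square)
  have "l = 1 + ln (N / k)" using pos N by (simp add: l_def ln_mult ln_div)
  moreover have "ln (N / k) = - ln (k / N)" using pos N by (simp add: ln_div)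
  ultimately have l: "l = 1 - ln v - ln w - ln t" using v w t by (simp add: kN ln_mult)
  have l1: "1 \<le> l" using pos N by (simp add: \<open>l = 1 + ln (N / k)\<close>)
  \<comment> \<open>The threshold depends on the ratio \<open>w\<close> of the two levels, so that both resulting bounds
      are summable along one of the two level indices.\<close>
  define R where "R = exp (1 + y / 2 * l)"
  show ?thesis
  proof (cases "e \<le> R * \<mu>")
    case True
    \<comment> \<open>The choice \<open>y = sqrt w\<close> tames \<open>ln w\<close>, which enters
      only as \<open>y * (- ln y) \<le> 1\<close>. Half of \<open>ln v\<close> is kept as
      \<open>sqrt v\<close>; the rest costs \<open>ln 2\<close> because \<open>v \<le> 4\<close>.
      The \<open>5 / 2\<close> is the sum of 1, \<open>y / 2 \<le> 1 / 2\<close> and 1.\<close>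
    have "t * v * R \<le> 2 * exp (5 / 2) * sqrt v"
    proof -
      have ylny: "y * (- ln y) \<le> 1"
      proof -
        have "- ln y = ln (1 / y)" using y by (simp add: ln_div)
        also have "\<dots> \<le> 1 / y - 1" using y by (intro ln_le_minus_one) simp
        finally have "y * (- ln y) \<le> y * (1 / y - 1)" using y by (intro mult_left_mono) auto
        then show ?thesis using y by (simp add: algebra_simps)
      qed
      have lnw: "ln w = 2 * ln y" using y by (simp add: ln_realpow flip: y(3))
      have lnv: "(1 / 2 - y / 2) * ln v \<le> ln 2"
      proof (cases "ln v \<le> 0")
        case True
        then have "(1 / 2 - y / 2) * ln v \<le> 0" using y by (intro mult_nonneg_nonpos) auto
        then show ?thesis by (smt (verit) ln_ge_zero)
      next
        case False
        have "(1 / 2 - y / 2) * ln v \<le> 1 / 2 * ln 4"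
          using False v y by (intro mult_mono) auto
        also have "ln 4 = 2 * ln (2 :: real)" using ln_realpow[of 2 2] by simp
        finally show ?thesis by simp
      qed
      have lnt: "(1 - y / 2) * ln t \<le> 0" using t y by (intro mult_nonneg_nonpos) auto
      have "t * v * R = exp (ln t + ln v + (1 + y / 2 * l))"
        using t v by (simp add: R_def exp_add)
      also have "ln t + ln v + (1 + y / 2 * l) =
          1 + y / 2 + (1 - y / 2) * ln t + ((1 / 2 - y / 2) * ln v + ln v / 2) + y * (- ln y)"
        by (simp add: l lnw field_simps)
      also have "\<dots> \<le> 5 / 2 + ln 2 + ln v / 2"
        using ylny lnv lnt y by linarith
      also have "exp (5 / 2 + ln 2 + ln v / 2) = 2 * exp (5 / 2) * sqrt v"
        using v by (simp add: exp_add ln_sqrt[symmetric])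
      finally show ?thesis by simp
    qed
    moreover have "\<alpha> * \<beta> * (R * \<mu>) = G * (m * (s * \<alpha>\<^sup>2)) * (t * v * R)"
      using pos N G(1) by (simp add: \<mu>_def v_def t_def G(2) field_simps power2_eq_square)
    moreover have "0 \<le> G * (m * (s * \<alpha>\<^sup>2))" using pos G by simp
    ultimately have "\<alpha> * \<beta> * (R * \<mu>) \<le> G * (m * (s * \<alpha>\<^sup>2)) * (2 * exp (5 / 2) * sqrt v)"
      by (metis mult_left_mono)
    moreover have "\<alpha> * \<beta> * e \<le> \<alpha> * \<beta> * (R * \<mu>)" using True pos by (intro mult_left_mono) auto
    moreover have "0 \<le> G * (2 * \<kappa> * t * y)" using G pos t y by simp
    ultimately show ?thesis
      unfolding G_def[symmetric] v_def[symmetric] w_def[symmetric] y_def[symmetric] t_def[symmetric]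
      by (simp add: algebra_simps)
  next
    case False
    then have e: "0 < e" using \<mu> by (smt (verit) R_def exp_gt_zero mult_pos_pos)
    have "exp (y / 2 * l) * (exp 1 * \<mu>) \<le> e"
      using False by (simp add: R_def exp_add mult_ac)
    then have "exp (y / 2 * l) \<le> e / (exp 1 * \<mu>)" using \<mu> by (simp add: pos_le_divide_eq)
    then have "y / 2 * l \<le> ln (e / (exp 1 * \<mu>))"
      using e \<mu> by (subst ln_ge_iff) auto
    then have "e * (y / 2 * l) \<le> e * ln (e / (exp 1 * \<mu>))" using e by (intro mult_left_mono) auto
    also have "\<dots> \<le> \<kappa> * (k * l)" using disc by (simp add: l_def \<mu>_def)
    finally have "(e * y) * l \<le> (2 * \<kappa> * k) * l" by (simp add: algebra_simps)
    \<comment> \<open>Cancelling the entropy factor \<open>l \<ge> 1\<close> leaves no logarithm in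
      the final bound.\<close>
    then have "e * y \<le> 2 * \<kappa> * k" using l1 by simp
    then have le: "(G * \<beta>\<^sup>2 * y) * (e * y) \<le> (G * \<beta>\<^sup>2 * y) * (2 * \<kappa> * k)"
      using G y by (intro mult_left_mono) auto
    have "\<alpha> * \<beta> = G * \<beta>\<^sup>2 * y\<^sup>2"
      unfolding y(3) w_def using pos G by (simp add: field_simps power2_eq_square)
    then have eq: "\<alpha> * \<beta> * e = (G * \<beta>\<^sup>2 * y) * (e * y)"
      by (simp only: power2_eq_square[of y] mult_ac)
    have "\<alpha> * \<beta> * e \<le> (G * \<beta>\<^sup>2 * y) * (2 * \<kappa> * k)" unfolding eq by (rule le)
    moreover have "0 \<le> G * (2 * exp (5 / 2) * m * (s * \<alpha>\<^sup>2) * sqrt v)" using G pos v by simp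
    ultimately show ?thesis
      unfolding G_def[symmetric] v_def[symmetric] w_def[symmetric] y_def[symmetric]
      by (simp add: algebra_simps)
  qed
qed

text \<open>For balanced pairs, the term with \<open>v\<close> is summed over \<open>q\<close> at
  fixed \<open>p\<close>, where heaviness caps \<open>v\<close> at 2, and the term with
  \<open>w\<close> over \<open>p\<close> at fixed \<open>q\<close>, where balance caps
  \<open>w\<close> at 1. A geometric sum is at most four times its cap and the masses sum to at most
  1, so \<open>16 = 2 * 4 * 2\<close> and \<open>8 = 2 * 4\<close>. Row sums refer to the first
  index and the entropy to the second, so the caller has to orient each pair of levels.\<close>

lemma heavy_levels_sum_bound:
  fixes P Q :: "int set" and s k :: "int \<Rightarrow> real" and e :: "int \<Rightarrow> int \<Rightarrow> real" and D m \<kappa> N \<Delta> :: real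
  defines "a \<equiv> \<lambda>p::int. 2 powr (of_int p) :: real"
  assumes fin: "finite P" "finite Q" and X: "X \<subseteq> P \<times> Q"
    and pos: "0 < D" "0 < m" "0 \<le> \<kappa>" "0 \<le> \<Delta>"
    and e: "\<And>p q. 0 \<le> e p q"
    and s: "\<And>p. p \<in> P \<Longrightarrow> 0 < s p" "(\<Sum>p\<in>P. s p * (a p)\<^sup>2) \<le> 1"
    and k: "\<And>q. q \<in> Q \<Longrightarrow> 0 < k q" "\<And>q. q \<in> Q \<Longrightarrow> k q \<le> N" "(\<Sum>q\<in>Q. k q * (a q)\<^sup>2) \<le> 1"
    and rows: "\<And>p. p \<in> P \<Longrightarrow> (\<Sum>q\<in>Q. e p q) \<le> s p * \<Delta>"
    and heavy: "\<And>p q. (p, q) \<in> X \<Longrightarrow> sqrt D / (4 * N) \<le> a p * a q"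
    and disc: "\<And>p q. (p, q) \<in> X \<Longrightarrow>
       e p q * ln (e p q / (exp 1 * (m * s p * k q * D / N))) \<le> \<kappa> * (k q * ln (exp 1 * N / k q))"
  shows "(\<Sum>(p,q)\<in>X. a p * a q * e p q) \<le> \<Delta> / sqrt D + sqrt D * (16 * exp (5 / 2) * m + 8 * \<kappa>)"
proof -
  have a: "0 < a p" for p by (simp add: a_def)
  have sqrt_a: "sqrt (a p) = 2 powr (of_int p / 2)" for p
    by (simp add: a_def powr_half_sqrt[symmetric] powr_powr)
  define G where "G = sqrt D"
  have G: "0 < G" using pos by (simp add: G_def)
  have finX: "finite X" using fin X finite_subset by blast
  \<comment> \<open>The levels in \<open>X1\<close> are so unbalanced that the row sums suffice.\<close>
  define X1 where "X1 = {(p, q) \<in> X. G * a q < a p}"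
  define X2 where "X2 = {(p, q) \<in> X. a p \<le> G * a q}"
  have split: "X = X1 \<union> X2" "X1 \<inter> X2 = {}" "finite X1" "finite X2"
    using finX by (auto simp: X1_def X2_def intro: finite_subset[OF _ finX])
  have "(\<Sum>(p,q)\<in>X1. a p * a q * e p q) \<le> (\<Sum>(p,q)\<in>X1. (a p)\<^sup>2 / G * e p q)"
  proof (rule sum_mono, clarify)
    fix p q assume "(p, q) \<in> X1"
    then have "a q \<le> a p / G" using G by (simp add: X1_def field_simps)
    then have "a p * a q \<le> a p * (a p / G)" using a by (intro mult_left_mono) (auto intro: less_imp_le)
    then show "a p * a q * e p q \<le> (a p)\<^sup>2 / G * e p q"
      using e by (intro mult_right_mono) (auto simp: power2_eq_square)
  qed
  also have "\<dots> \<le> (\<Sum>(p,q)\<in>P \<times> Q. (a p)\<^sup>2 / G * e p q)"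
    using fin X e G by (intro sum_mono2) (auto simp: X1_def)
  also have "\<dots> = (\<Sum>p\<in>P. (a p)\<^sup>2 / G * (\<Sum>q\<in>Q. e p q))"
    by (simp add: sum.cartesian_product[symmetric] sum_distrib_left)
  also have "\<dots> \<le> (\<Sum>p\<in>P. (a p)\<^sup>2 / G * (s p * \<Delta>))"
    using rows G by (intro sum_mono mult_left_mono) auto
  also have "\<dots> = (\<Sum>p\<in>P. s p * (a p)\<^sup>2) * (\<Delta> / G)"
    by (simp add: sum_distrib_left algebra_simps sum_divide_distrib)
  also have "\<dots> \<le> 1 * (\<Delta> / G)" using s G pos by (intro mult_right_mono) auto
  finally have part1: "(\<Sum>(p,q)\<in>X1. a p * a q * e p q) \<le> \<Delta> / G" by simp

  define c where "c = 2 * exp (5 / 2) * m"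
  have c: "0 \<le> c" using pos by (simp add: c_def)
  define v where "v = (\<lambda>p q. sqrt (G / (N * a p * a q)))"
  define w where "w = (\<lambda>p q. sqrt (a p / (G * a q)))"
  have in_X: "p \<in> P" "q \<in> Q" "0 < N" if "(p, q) \<in> X" for p q
    using that X k(1,2)[of q] by (auto dest!: subsetD)
  have "(\<Sum>(p,q)\<in>X2. a p * a q * e p q) \<le>
      (\<Sum>(p,q)\<in>X2. G * (c * (s p * (a p)\<^sup>2) * v p q + 2 * \<kappa> * (k q * (a q)\<^sup>2) * w p q))"
  proof (rule sum_mono, clarify)
    fix p q assume pq: "(p, q) \<in> X2"
    then have pqX: "(p, q) \<in> X" and le: "a p \<le> sqrt D * a q" by (auto simp: X2_def G_def)
    have "k q * (a q)\<^sup>2 \<le> (\<Sum>q\<in>Q. k q * (a q)\<^sup>2)"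
      using in_X[OF pqX] fin k by (intro member_le_sum) (auto simp: less_imp_le)
    then have "k q * (a q)\<^sup>2 \<le> 1" using k by linarith
    then show "a p * a q * e p q \<le> G * (c * (s p * (a p)\<^sup>2) * v p q + 2 * \<kappa> * (k q * (a q)\<^sup>2) * w p q)"
      unfolding G_def c_def v_def w_def
      using in_X[OF pqX] pos s k e le
      by (intro heavy_level_bound a heavy[OF pqX] disc[OF pqX]) auto
  qed
  also have "\<dots> = G * (\<Sum>(p,q)\<in>X2. c * (s p * (a p)\<^sup>2) * v p q)
      + G * (\<Sum>(p,q)\<in>X2. 2 * \<kappa> * (k q * (a q)\<^sup>2) * w p q)"
    by (simp add: case_prod_unfold sum.distrib[symmetric] sum_distrib_left algebra_simps)
  also have "(\<Sum>(p,q)\<in>X2. c * (s p * (a p)\<^sup>2) * v p q) \<le> 8 * c"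
  proof -
    have inner: "(\<Sum>q\<in>{q. (p, q) \<in> X2}. v p q) \<le> 4 * 2" if "p \<in> P" for p
    proof (cases "N > 0")
      case True
      have fin': "finite {q. (p, q) \<in> X2}"
        by (rule finite_subset[OF _ fin(2)]) (use X in \<open>auto simp: X2_def\<close>)
      have eq: "v p q = sqrt (G / (N * a p)) * 2 powr (- of_int q / 2)" for q
        by (simp add: v_def real_sqrt_divide real_sqrt_mult sqrt_a powr_minus_divide)
      have v2: "v p q \<le> 2" if "(p, q) \<in> X2" for q
      proof -
        have "G / (N * a p * a q) \<le> 4"
          using heavy[of p q] that True a[of p] a[of q] by (auto simp: X2_def G_def field_simps)
        then have "v p q \<le> sqrt 4" unfolding v_def by (rule real_sqrt_le_mono)
        then show ?thesis by simp
      qed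
      show ?thesis
        unfolding eq using fin' v2[unfolded eq] True G a[of p]
        by (intro geometric_sum_sqrt2_decreasing_le) auto
    next
      case False
      then have "{q. (p, q) \<in> X2} = {}" using in_X by (auto simp: X2_def)
      then show ?thesis by simp
    qed
    have "(\<Sum>(p,q)\<in>X2. c * (s p * (a p)\<^sup>2) * v p q) =
        (\<Sum>p\<in>P. \<Sum>q\<in>{q. (p, q) \<in> X2}. c * (s p * (a p)\<^sup>2) * v p q)"
    proof (subst sum.Sigma)
      show "\<forall>p\<in>P. finite {q. (p, q) \<in> X2}"
        by (auto intro: finite_subset[OF _ fin(2)] simp: X2_def dest: in_X)
      have "X2 = (SIGMA p:P. {q. (p, q) \<in> X2})" using in_X by (auto simp: X2_def)
      then show "(\<Sum>(p,q)\<in>X2. c * (s p * (a p)\<^sup>2) * v p q) =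
        (\<Sum>(p,q)\<in>(SIGMA p:P. {q. (p, q) \<in> X2}). c * (s p * (a p)\<^sup>2) * v p q)" by simp
    qed (use fin in auto)
    also have "\<dots> = (\<Sum>p\<in>P. c * (s p * (a p)\<^sup>2) * (\<Sum>q\<in>{q. (p, q) \<in> X2}. v p q))"
      by (simp add: sum_distrib_left)
    also have "\<dots> \<le> (\<Sum>p\<in>P. c * (s p * (a p)\<^sup>2) * 8)"
      using inner s c by (intro sum_mono mult_left_mono) (auto simp: less_imp_le)
    also have "\<dots> = 8 * c * (\<Sum>p\<in>P. s p * (a p)\<^sup>2)" by (simp add: sum_distrib_left algebra_simps)
    also have "\<dots> \<le> 8 * c * 1" using s c by (intro mult_left_mono) auto
    finally show ?thesis by simp
  qed
  also have "(\<Sum>(p,q)\<in>X2. 2 * \<kappa> * (k q * (a q)\<^sup>2) * w p q) \<le> 8 * \<kappa>"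
  proof -
    have inner: "(\<Sum>p\<in>{p. (p, q) \<in> X2}. w p q) \<le> 4 * 1" if "q \<in> Q" for q
    proof -
      have fin': "finite {p. (p, q) \<in> X2}"
        by (rule finite_subset[OF _ fin(1)]) (use X in \<open>auto simp: X2_def\<close>)
      have eq: "w p q = sqrt (1 / (G * a q)) * 2 powr (of_int p / 2)" for p
        by (simp add: w_def real_sqrt_divide real_sqrt_mult sqrt_a)
      have w1: "w p q \<le> 1" if "(p, q) \<in> X2" for p
        using that G a[of q] by (auto simp: w_def X2_def field_simps)
      show ?thesis
        unfolding eq using fin' w1[unfolded eq] G a[of q]
        by (intro geometric_sum_sqrt2_le) auto
    qed
    have "(\<Sum>(p,q)\<in>X2. 2 * \<kappa> * (k q * (a q)\<^sup>2) * w p q) =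
        (\<Sum>(q,p)\<in>prod.swap ` X2. 2 * \<kappa> * (k q * (a q)\<^sup>2) * w p q)"
      by (subst sum.reindex) (auto simp: inj_on_def case_prod_unfold)
    also have "\<dots> = (\<Sum>q\<in>Q. \<Sum>p\<in>{p. (p, q) \<in> X2}. 2 * \<kappa> * (k q * (a q)\<^sup>2) * w p q)"
    proof (subst sum.Sigma)
      show "\<forall>q\<in>Q. finite {p. (p, q) \<in> X2}"
        by (auto intro: finite_subset[OF _ fin(1)] simp: X2_def dest: in_X)
      have "prod.swap ` X2 = (SIGMA q:Q. {p. (p, q) \<in> X2})" using in_X by (force simp: X2_def)
      then show "(\<Sum>(q,p)\<in>prod.swap ` X2. 2 * \<kappa> * (k q * (a q)\<^sup>2) * w p q) =
        (\<Sum>(q,p)\<in>(SIGMA q:Q. {p. (p, q) \<in> X2}). 2 * \<kappa> * (k q * (a q)\<^sup>2) * w p q)" by simp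
    qed (use fin in auto)
    also have "\<dots> = (\<Sum>q\<in>Q. 2 * \<kappa> * (k q * (a q)\<^sup>2) * (\<Sum>p\<in>{p. (p, q) \<in> X2}. w p q))"
      by (simp add: sum_distrib_left)
    also have "\<dots> \<le> (\<Sum>q\<in>Q. 2 * \<kappa> * (k q * (a q)\<^sup>2) * 4)"
      using inner k pos by (intro sum_mono mult_left_mono) (auto simp: less_imp_le)
    also have "\<dots> = 8 * \<kappa> * (\<Sum>q\<in>Q. k q * (a q)\<^sup>2)" by (simp add: sum_distrib_left algebra_simps)
    also have "\<dots> \<le> 8 * \<kappa> * 1" using k pos by (intro mult_left_mono) auto
    finally show ?thesis by simp
  qed
  finally have part2: "(\<Sum>(p,q)\<in>X2. a p * a q * e p q) \<le> G * (8 * c) + G * (8 * \<kappa>)"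
    using G by (simp add: mult_left_mono)
  have "(\<Sum>(p,q)\<in>X. a p * a q * e p q) =
      (\<Sum>(p,q)\<in>X1. a p * a q * e p q) + (\<Sum>(p,q)\<in>X2. a p * a q * e p q)"
    using split by (simp add: sum.union_disjoint)
  also have "\<dots> \<le> \<Delta> / G + G * (8 * c) + G * (8 * \<kappa>)" using part1 part2 by simp
  finally show ?thesis by (simp add: G_def c_def algebra_simps)
qed


section \<open>Dyadic decomposition of a pair of vectors\<close>

definition dyadic_level :: "real \<Rightarrow> int" where
  "dyadic_level x = \<lfloor>log 2 x\<rfloor>"

lemma dyadic_level_bounds:
  assumes "0 < x"
  shows "2 powr of_int (dyadic_level x) \<le> x" "x \<le> 2 * 2 powr of_int (dyadic_level x)"
proof -
  have x: "x = 2 powr log 2 x" using assms by simp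
  show "2 powr of_int (dyadic_level x) \<le> x"
    unfolding dyadic_level_def by (subst (2) x, rule powr_mono) auto
  have "x \<le> 2 powr (1 + of_int (dyadic_level x))"
    unfolding dyadic_level_def by (subst x, rule powr_mono) (auto, linarith)
  then show "x \<le> 2 * 2 powr of_int (dyadic_level x)" by (simp add: powr_add)
qed

text \<open>Rounding entries down to powers of two does not increase the sum of squares. This yields
  the mass hypotheses on \<open>s\<close> and \<open>k\<close> above.\<close>

lemma level_sizes_bound:
  fixes a :: "'a \<Rightarrow> real"
  assumes "finite V" "(\<Sum>i\<in>V. (a i)\<^sup>2) \<le> 1"
  defines "W \<equiv> {i \<in> V. 0 < a i}"
  shows "(\<Sum>p\<in>(\<lambda>i. dyadic_level (a i)) ` W. real (card {i \<in> W. dyadic_level (a i) = p}) * (2 powr of_int p)\<^sup>2) \<le> 1"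
proof -
  have fin: "finite W" using assms by simp
  have "(\<Sum>p\<in>(\<lambda>i. dyadic_level (a i)) ` W. real (card {i \<in> W. dyadic_level (a i) = p}) * (2 powr of_int p)\<^sup>2)
      = (\<Sum>p\<in>(\<lambda>i. dyadic_level (a i)) ` W. \<Sum>i\<in>{i \<in> W. dyadic_level (a i) = p}. (2 powr of_int (dyadic_level (a i)))\<^sup>2)"
    by (intro sum.cong) auto
  also have "\<dots> = (\<Sum>i\<in>W. (2 powr of_int (dyadic_level (a i)))\<^sup>2)"
    by (rule sum.image_gen[OF fin, symmetric])
  also have "\<dots> \<le> (\<Sum>i\<in>W. (a i)\<^sup>2)"
    using dyadic_level_bounds(1) by (intro sum_mono power_mono) (auto simp: W_def)
  also have "\<dots> \<le> (\<Sum>i\<in>V. (a i)\<^sup>2)" using assms by (intro sum_mono2) auto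
  finally show ?thesis using assms by simp
qed

text \<open>Replacing an entry by the power of two below it loses at most a factor 2 in each vector,
  hence 4 in the sum and in the threshold \<open>sqrt D / (4 * N)\<close>. The two cases for which
  level is larger turn 4 into 8. \<open>rows\<close> is demanded only where \<open>a\<close> or
  \<open>b\<close> is positive, so large degrees outside the supports do no harm.\<close>

lemma heavy_pairs_bound:
  fixes V :: "'a set" and A :: "'a \<Rightarrow> 'a \<Rightarrow> real" and a b :: "'a \<Rightarrow> real" and D m \<kappa> \<Delta> :: real
  defines "N \<equiv> real (card V)"
  assumes V: "finite V"
    and pos: "0 < D" "0 < m" "0 \<le> \<kappa>" "0 \<le> \<Delta>"
    and A: "\<And>i j. 0 \<le> A i j" "\<And>i j. A i j = A j i"
    and a: "(\<Sum>i\<in>V. (a i)\<^sup>2) \<le> 1" "\<And>i. i \<in> V \<Longrightarrow> 0 \<le> a i"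
    and b: "(\<Sum>i\<in>V. (b i)\<^sup>2) \<le> 1" "\<And>i. i \<in> V \<Longrightarrow> 0 \<le> b i"
    and rows: "\<And>i. i \<in> V \<Longrightarrow> 0 < a i \<or> 0 < b i \<Longrightarrow> (\<Sum>j\<in>V. A i j) \<le> \<Delta>"
    and disc: "\<And>S T. S \<subseteq> V \<Longrightarrow> T \<subseteq> V \<Longrightarrow> S \<noteq> {} \<Longrightarrow> T \<noteq> {} \<Longrightarrow> card S \<le> card T \<Longrightarrow>
       (\<Sum>i\<in>S. \<Sum>j\<in>T. A i j) * ln ((\<Sum>i\<in>S. \<Sum>j\<in>T. A i j) / (exp 1 * (m * real (card S) * real (card T) * D / N)))
       \<le> \<kappa> * (real (card T) * ln (exp 1 * N / real (card T)))"
  shows "(\<Sum>i\<in>V. \<Sum>j\<in>V. of_bool (sqrt D / N < a i * b j) * (a i * b j * A i j))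
     \<le> 8 * (\<Delta> / sqrt D + sqrt D * (16 * exp (5 / 2) * m + 8 * \<kappa>))"
proof -
  define pw where "pw = (\<lambda>p::int. 2 powr (of_int p) :: real)"
  have pw: "0 < pw p" for p by (simp add: pw_def)
  define Va where "Va = {i \<in> V. 0 < a i}"
  define Vb where "Vb = {i \<in> V. 0 < b i}"
  define P where "P = (\<lambda>i. dyadic_level (a i)) ` Va"
  define Q where "Q = (\<lambda>i. dyadic_level (b i)) ` Vb"
  define S where "S = (\<lambda>p. {i \<in> Va. dyadic_level (a i) = p})"
  define T where "T = (\<lambda>q. {i \<in> Vb. dyadic_level (b i) = q})"
  define e where "e = (\<lambda>p q. \<Sum>i\<in>S p. \<Sum>j\<in>T q. A i j)"
  define X where "X = {(p, q) \<in> P \<times> Q. sqrt D / (4 * N) \<le> pw p * pw q}"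
  define X1 where "X1 = {(p, q) \<in> X. card (S p) \<le> card (T q)}"
  define X2 where "X2 = {(p, q) \<in> X. \<not> card (S p) \<le> card (T q)}"
  have fin: "finite Va" "finite Vb" "finite P" "finite Q" "finite (S p)" "finite (T p)" for p
    using V by (simp_all add: Va_def Vb_def P_def Q_def S_def T_def)
  have sub: "S p \<subseteq> V" "T p \<subseteq> V" for p by (auto simp: S_def T_def Va_def Vb_def)
  have ne: "p \<in> P \<Longrightarrow> S p \<noteq> {}" "p \<in> Q \<Longrightarrow> T p \<noteq> {}" for p by (auto simp: P_def S_def Q_def T_def)
  have card_pos: "p \<in> P \<Longrightarrow> 0 < card (S p)" "p \<in> Q \<Longrightarrow> 0 < card (T p)" for p
    using ne fin by (auto simp: card_gt_0_iff)
  have card_le: "real (card (S p)) \<le> N" "real (card (T p)) \<le> N" for p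
    using card_mono[OF V sub(1)] card_mono[OF V sub(2)] by (simp_all add: N_def)
  have e_sym: "e p q = (\<Sum>j\<in>T q. \<Sum>i\<in>S p. A j i)" for p q
    unfolding e_def by (subst sum.swap) (simp add: A(2))
  have e_nonneg: "0 \<le> e p q" for p q by (simp add: e_def sum_nonneg A(1))
  have group_b: "(\<Sum>j\<in>Vb. f j) = (\<Sum>q\<in>Q. \<Sum>j\<in>T q. f j)" for f :: "'a \<Rightarrow> real"
    unfolding Q_def T_def by (rule sum.image_gen[OF fin(2)])
  have group_a: "(\<Sum>j\<in>Va. f j) = (\<Sum>p\<in>P. \<Sum>j\<in>S p. f j)" for f :: "'a \<Rightarrow> real"
    unfolding P_def S_def by (rule sum.image_gen[OF fin(1)])
  have rows_a: "(\<Sum>q\<in>Q. e p q) \<le> real (card (S p)) * \<Delta>" for p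
  proof -
    have "(\<Sum>q\<in>Q. e p q) = (\<Sum>i\<in>S p. \<Sum>j\<in>Vb. A i j)"
      unfolding e_def group_b by (rule sum.swap)
    also have "\<dots> \<le> (\<Sum>i\<in>S p. \<Delta>)"
    proof (rule sum_mono)
      fix i assume i: "i \<in> S p"
      have "(\<Sum>j\<in>Vb. A i j) \<le> (\<Sum>j\<in>V. A i j)" using V A by (intro sum_mono2) (auto simp: Vb_def)
      also have "\<dots> \<le> \<Delta>" using i by (intro rows) (auto simp: S_def Va_def)
      finally show "(\<Sum>j\<in>Vb. A i j) \<le> \<Delta>" .
    qed
    finally show ?thesis by simp
  qed
  have rows_b: "(\<Sum>p\<in>P. e p q) \<le> real (card (T q)) * \<Delta>" for q
  proof -
    have "(\<Sum>p\<in>P. e p q) = (\<Sum>j\<in>T q. \<Sum>i\<in>Va. A j i)"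
      unfolding e_sym group_a by (rule sum.swap)
    also have "\<dots> \<le> (\<Sum>i\<in>T q. \<Delta>)"
    proof (rule sum_mono)
      fix i assume i: "i \<in> T q"
      have "(\<Sum>j\<in>Va. A i j) \<le> (\<Sum>j\<in>V. A i j)" using V A by (intro sum_mono2) (auto simp: Va_def)
      also have "\<dots> \<le> \<Delta>" using i by (intro rows) (auto simp: T_def Vb_def)
      finally show "(\<Sum>j\<in>Va. A i j) \<le> \<Delta>" .
    qed
    finally show ?thesis by simp
  qed
  have norm_a: "(\<Sum>p\<in>P. real (card (S p)) * (pw p)\<^sup>2) \<le> 1"
    using level_sizes_bound[OF V a(1)] by (simp add: P_def S_def Va_def pw_def)
  have norm_b: "(\<Sum>q\<in>Q. real (card (T q)) * (pw q)\<^sup>2) \<le> 1"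
    using level_sizes_bound[OF V b(1)] by (simp add: Q_def T_def Vb_def pw_def)
  let ?K = "\<Delta> / sqrt D + sqrt D * (16 * exp (5 / 2) * m + 8 * \<kappa>)"
  have part1: "(\<Sum>(p,q)\<in>X1. pw p * pw q * e p q) \<le> ?K"
    unfolding pw_def
  proof (rule heavy_levels_sum_bound[where P = P and Q = Q and N = N])
    fix p q assume pq: "(p, q) \<in> X1"
    then have "p \<in> P" "q \<in> Q" and le: "card (S p) \<le> card (T q)" by (auto simp: X1_def X_def)
    then show "e p q * ln (e p q / (exp 1 * (m * real (card (S p)) * real (card (T q)) * D / N)))
       \<le> \<kappa> * (real (card (T q)) * ln (exp 1 * N / real (card (T q))))"
      unfolding e_def using sub ne by (intro disc) auto
    show "sqrt D / (4 * N) \<le> 2 powr of_int p * 2 powr of_int q"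
      using pq by (auto simp: X1_def X_def pw_def)
  qed (use fin card_pos card_le pos norm_a norm_b rows_a e_nonneg in \<open>auto simp: X1_def X_def pw_def\<close>)
  \<comment> \<open>Symmetry of \<open>A\<close> allows the roles of the vectors to be exchanged, so
    that the larger level, now \<open>S p\<close>, is again the second one as \<open>disc\<close>
    demands.\<close>
  have part2: "(\<Sum>(q,p)\<in>prod.swap ` X2. pw q * pw p * e p q) \<le> ?K"
    unfolding pw_def
  proof (rule heavy_levels_sum_bound[where P = Q and Q = P and N = N and e = "\<lambda>q p. e p q"])
    fix q p assume pq: "(q, p) \<in> prod.swap ` X2"
    then have "p \<in> P" "q \<in> Q" and le: "card (T q) \<le> card (S p)" by (auto simp: X2_def X_def)
    then show "e p q * ln (e p q / (exp 1 * (m * real (card (T q)) * real (card (S p)) * D / N)))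
       \<le> \<kappa> * (real (card (S p)) * ln (exp 1 * N / real (card (S p))))"
      unfolding e_sym using sub ne by (intro disc) auto
    show "sqrt D / (4 * N) \<le> 2 powr of_int q * 2 powr of_int p"
      using pq by (auto simp: X2_def X_def pw_def mult.commute)
  qed (use fin card_pos card_le pos norm_a norm_b rows_b e_nonneg in \<open>auto simp: X2_def X_def pw_def\<close>)
  let ?f = "\<lambda>i j. of_bool (sqrt D / N < a i * b j) * (a i * b j * A i j)"
  have "(\<Sum>i\<in>V. \<Sum>j\<in>V. ?f i j) = (\<Sum>i\<in>Va. \<Sum>j\<in>Vb. ?f i j)"
  proof -
    have "(\<Sum>j\<in>V. ?f i j) = (\<Sum>j\<in>Vb. ?f i j)" for i
      using V b by (intro sum.mono_neutral_right) (force simp: Vb_def)+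
    moreover have "(\<Sum>i\<in>V. \<Sum>j\<in>Vb. ?f i j) = (\<Sum>i\<in>Va. \<Sum>j\<in>Vb. ?f i j)"
      using V a by (intro sum.mono_neutral_right) (force simp: Va_def)+
    ultimately show ?thesis by simp
  qed
  also have "\<dots> = (\<Sum>p\<in>P. \<Sum>i\<in>S p. \<Sum>q\<in>Q. \<Sum>j\<in>T q. ?f i j)"
    unfolding group_a group_b ..
  also have "\<dots> = (\<Sum>p\<in>P. \<Sum>q\<in>Q. \<Sum>i\<in>S p. \<Sum>j\<in>T q. ?f i j)"
    by (intro sum.cong refl sum.swap)
  \<comment> \<open>Level pairs outside \<open>X\<close> contain no heavy pair, since there
    \<open>a i * b j \<le> 4 * (pw p * pw q) < sqrt D / N\<close>.\<close>
  also have "\<dots> \<le> (\<Sum>p\<in>P. \<Sum>q\<in>Q. of_bool ((p, q) \<in> X) * (4 * (pw p * pw q * e p q)))"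
  proof (intro sum_mono)
    fix p q assume "p \<in> P" "q \<in> Q"
    have "(\<Sum>i\<in>S p. \<Sum>j\<in>T q. ?f i j) \<le> (\<Sum>i\<in>S p. \<Sum>j\<in>T q. of_bool ((p, q) \<in> X) * (4 * (pw p * pw q)) * A i j)"
    proof (intro sum_mono)
      fix i j assume i: "i \<in> S p" and j: "j \<in> T q"
      have ai: "0 < a i" "a i \<le> 2 * pw p" and bj: "0 < b j" "b j \<le> 2 * pw q"
        using i j dyadic_level_bounds(2)[of "a i"] dyadic_level_bounds(2)[of "b j"]
        by (auto simp: S_def T_def Va_def Vb_def pw_def)
      have le: "a i * b j \<le> 4 * (pw p * pw q)"
        using mult_mono[OF ai(2) bj(2)] ai bj pw[of p] by simp
      show "?f i j \<le> of_bool ((p, q) \<in> X) * (4 * (pw p * pw q)) * A i j"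
      proof (cases "sqrt D / N < a i * b j")
        case True
        then have "sqrt D / (4 * N) \<le> pw p * pw q" using le by simp
        then have "(p, q) \<in> X" using \<open>p \<in> P\<close> \<open>q \<in> Q\<close> by (simp add: X_def)
        then show ?thesis using True le A(1)[of i j] by (simp add: mult_right_mono)
      qed (use A(1)[of i j] pw[of p] pw[of q] in simp)
    qed
    also have "\<dots> = of_bool ((p, q) \<in> X) * (4 * (pw p * pw q * e p q))"
      by (simp add: e_def sum_distrib_left mult.assoc)
    finally show "(\<Sum>i\<in>S p. \<Sum>j\<in>T q. ?f i j) \<le> of_bool ((p, q) \<in> X) * (4 * (pw p * pw q * e p q))" .
  qed
  also have "\<dots> = (\<Sum>(p,q)\<in>P \<times> Q. of_bool ((p, q) \<in> X) * (4 * (pw p * pw q * e p q)))"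
    by (rule sum.cartesian_product)
  also have "\<dots> = (\<Sum>(p,q)\<in>X. 4 * (pw p * pw q * e p q))"
    using fin by (intro sum.mono_neutral_cong_right) (auto simp: X_def)
  also have "\<dots> = 4 * (\<Sum>(p,q)\<in>X. pw p * pw q * e p q)"
    by (simp add: sum_distrib_left case_prod_unfold)
  also have "X = X1 \<union> X2" by (auto simp: X1_def X2_def)
  also have "(\<Sum>(p,q)\<in>X1 \<union> X2. pw p * pw q * e p q) =
      (\<Sum>(p,q)\<in>X1. pw p * pw q * e p q) + (\<Sum>(p,q)\<in>X2. pw p * pw q * e p q)"
  proof (rule sum.union_disjoint)
    have "X \<subseteq> P \<times> Q" by (auto simp: X_def)
    then have "finite X" using fin by (meson finite_SigmaI finite_subset)
    then show "finite X1" "finite X2" 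
      by (auto simp: X1_def X2_def intro: finite_subset[where B = X])
  qed (auto simp: X1_def X2_def)
  also have "(\<Sum>(p,q)\<in>X2. pw p * pw q * e p q) = (\<Sum>(q,p)\<in>prod.swap ` X2. pw q * pw p * e p q)"
    by (subst sum.reindex) (auto simp: inj_on_def case_prod_unfold mult.commute)
  also have "4 * ((\<Sum>(p,q)\<in>X1. pw p * pw q * e p q) + \<dots>) \<le> 4 * (?K + ?K)"
    using part1 part2 by simp
  finally show ?thesis by simp
qed


section \<open>A net for the spectral norm\<close>

text \<open>Integer coordinates of the grid points in the unit ball, in units of the spacing. The
  extensional box makes finiteness immediate and lets sums factor over coordinates; its half-width
  \<open>4 * N\<close> covers \<open>4 * sqrt N\<close>.\<close>

definition integer_net :: "nat \<Rightarrow> (nat \<Rightarrow> int) set" where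
  "integer_net N = {z \<in> {1..N} \<rightarrow>\<^sub>E {- 4 * int N..4 * int N}. (\<Sum>i\<in>{1..N}. (z i)\<^sup>2) \<le> 16 * int N}"

text \<open>The spacing \<open>1 / (4 sqrt N)\<close> makes the rounding error of a unit vector at most
  \<open>1 / 4\<close>.\<close>

definition grid_vector :: "nat \<Rightarrow> (nat \<Rightarrow> int) \<Rightarrow> nat \<Rightarrow> real" where
  "grid_vector N z i = of_int (z i) / (4 * sqrt (real N))"

lemma finite_integer_net: "finite (integer_net N)"
proof -
  have "finite ({1..N} \<rightarrow>\<^sub>E {- 4 * int N..4 * int N})" by (intro finite_PiE) auto
  then show ?thesis by (rule finite_subset[rotated]) (auto simp: integer_net_def)
qed

lemma sum_half_power_abs: "(\<Sum>y\<in>{- int n..int n}. (1 / 2 :: real) ^ nat \<bar>y\<bar>) \<le> 3"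
proof -
  have "(\<Sum>y\<in>{- int n..int n}. (1 / 2 :: real) ^ nat \<bar>y\<bar>) = 3 - 2 * (1 / 2) ^ n"
  proof (induction n)
    case (Suc n)
    have "{- int (Suc n)..int (Suc n)} = insert (- int (Suc n)) (insert (int (Suc n)) {- int n..int n})"
      by auto
    then show ?case using Suc by (simp add: nat_add_distrib)
  qed simp
  then show ?thesis by simp
qed

text \<open>Since a net vector has 1-norm at most \<open>4 N\<close>, weighting each vector by
  \<open>2\<close> to minus its 1-norm costs a factor of at most \<open>16\<close> per coordinate and
  makes the sum over the net a product.\<close>

lemma card_integer_net: "real (card (integer_net N)) \<le> 48 ^ N"
proof -
  have one_le: "1 \<le> 16 ^ N * (\<Prod>i\<in>{1..N}. (1 / 2 :: real) ^ nat \<bar>z i\<bar>)" if "z \<in> integer_net N" for z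
  proof -
    \<comment> \<open>Cauchy-Schwarz against the all-ones vector:
      \<open>16 * N * N = (4 * N)^2\<close>.\<close>
    have "(\<Sum>i\<in>{1..N}. real_of_int \<bar>z i\<bar> * 1)\<^sup>2 \<le> (\<Sum>i\<in>{1..N}. (real_of_int \<bar>z i\<bar>)\<^sup>2) * (\<Sum>i\<in>{1..N}. 1\<^sup>2)"
      by (rule Cauchy_Schwarz_ineq_sum)
    also have "(\<Sum>i\<in>{1..N}. (real_of_int \<bar>z i\<bar>)\<^sup>2) = real_of_int (\<Sum>i\<in>{1..N}. (z i)\<^sup>2)" by simp
    also have "\<dots> \<le> real_of_int (16 * int N)"
      using that by (simp only: of_int_le_iff integer_net_def mem_Collect_eq)
    finally have "(\<Sum>i\<in>{1..N}. real_of_int \<bar>z i\<bar>)\<^sup>2 \<le> (4 * real N)\<^sup>2"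
      by (simp add: power2_eq_square mult_right_mono)
    then have "(\<Sum>i\<in>{1..N}. real_of_int \<bar>z i\<bar>) \<le> 4 * real N" by (rule power2_le_imp_le) simp
    moreover have "(\<Sum>i\<in>{1..N}. real_of_int \<bar>z i\<bar>) = real (\<Sum>i\<in>{1..N}. nat \<bar>z i\<bar>)" by simp
    ultimately have "(\<Sum>i\<in>{1..N}. nat \<bar>z i\<bar>) \<le> 4 * N" by linarith
    then have "(1 / 2 :: real) ^ (4 * N) \<le> (1 / 2) ^ (\<Sum>i\<in>{1..N}. nat \<bar>z i\<bar>)"
      by (intro power_decreasing) auto
    also have "(1 / 2 :: real) ^ (4 * N) = 1 / 16 ^ N" by (simp add: power_mult power_divide)
    finally show ?thesis by (simp add: power_sum field_simps)
  qed
  have "real (card (integer_net N)) = (\<Sum>z\<in>integer_net N. 1)" by simp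
  also have "\<dots> \<le> (\<Sum>z\<in>integer_net N. 16 ^ N * (\<Prod>i\<in>{1..N}. (1 / 2 :: real) ^ nat \<bar>z i\<bar>))"
    by (intro sum_mono one_le)
  also have "\<dots> \<le> (\<Sum>z\<in>{1..N} \<rightarrow>\<^sub>E {- 4 * int N..4 * int N}. 16 ^ N * (\<Prod>i\<in>{1..N}. (1 / 2 :: real) ^ nat \<bar>z i\<bar>))"
    by (intro sum_mono2 finite_PiE) (auto simp: integer_net_def intro!: mult_nonneg_nonneg prod_nonneg)
  also have "\<dots> = 16 ^ N * (\<Prod>i\<in>{1..N}. \<Sum>y\<in>{- 4 * int N..4 * int N}. (1 / 2 :: real) ^ nat \<bar>y\<bar>)"
    by (subst prod_sum_PiE) (auto simp: sum_distrib_left)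
  also have "\<dots> \<le> 16 ^ N * (\<Prod>i\<in>{1..N}. 3)"
    using sum_half_power_abs[of "4 * N"] by (intro mult_left_mono prod_mono) (auto intro!: sum_nonneg)
  also have "\<dots> = 48 ^ N" by (simp add: power_mult_distrib[symmetric])
  finally show ?thesis .
qed

lemma grid_vector_norm:
  assumes "z \<in> integer_net N"
  shows "(\<Sum>i\<in>{1..N}. (grid_vector N z i)\<^sup>2) \<le> 1"
proof (cases "N = 0")
  case False
  have "(\<Sum>i\<in>{1..N}. (grid_vector N z i)\<^sup>2) = real_of_int (\<Sum>i\<in>{1..N}. (z i)\<^sup>2) / (16 * real N)"
    by (simp add: grid_vector_def power_divide power_mult_distrib sum_divide_distrib)
  also have "real_of_int (\<Sum>i\<in>{1..N}. (z i)\<^sup>2) \<le> real_of_int (16 * int N)"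
    using assms by (simp only: of_int_le_iff integer_net_def mem_Collect_eq)
  finally show ?thesis using False by (simp add: divide_right_mono)
qed simp

text \<open>Scaled coordinates are rounded towards zero: none grows in absolute value, so the
  constraint on the sum of squares survives. Each error is at most one spacing, and
  \<open>N * 1 / (16 * N) = (1 / 4)^2\<close>.\<close>

lemma exists_grid_approximation:
  assumes "0 < N" "(\<Sum>i\<in>{1..N}. (u i)\<^sup>2) \<le> (1 :: real)"
  shows "\<exists>z\<in>integer_net N. L2_set (\<lambda>i. u i - grid_vector N z i) {1..N} \<le> 1 / 4"
proof -
  define c where "c = 4 * sqrt (real N)"
  have c: "0 < c" "c\<^sup>2 = 16 * real N" using assms by (simp_all add: c_def power_mult_distrib)
  define trunc :: "real \<Rightarrow> int" where "trunc y = (if 0 \<le> y then \<lfloor>y\<rfloor> else \<lceil>y\<rceil>)" for y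
  have trunc_le: "\<bar>of_int (trunc y)\<bar> \<le> \<bar>y\<bar>" for y
    by (cases "0 \<le> y"; simp add: trunc_def; linarith)
  have trunc_diff: "\<bar>y - of_int (trunc y)\<bar> \<le> 1" for y
    by (cases "0 \<le> y"; simp add: trunc_def; linarith)
  define z where "z = restrict (\<lambda>i. trunc (c * u i)) {1..N}"
  have sq: "(of_int (z i))\<^sup>2 \<le> c\<^sup>2 * (u i)\<^sup>2" if "i \<in> {1..N}" for i
    using power_mono[OF trunc_le[of "c * u i"], of 2] that
    by (simp add: z_def power_mult_distrib)
  have sum_sq: "real_of_int (\<Sum>i\<in>{1..N}. (z i)\<^sup>2) \<le> 16 * real N"
  proof -
    have "real_of_int (\<Sum>i\<in>{1..N}. (z i)\<^sup>2) \<le> (\<Sum>i\<in>{1..N}. c\<^sup>2 * (u i)\<^sup>2)"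
      unfolding of_int_sum of_int_power by (intro sum_mono sq)
    also have "\<dots> \<le> c\<^sup>2 * 1"
      unfolding sum_distrib_left[symmetric] using assms by (intro mult_left_mono) auto
    finally show ?thesis using c by simp
  qed
  then have sum_sq': "(\<Sum>i\<in>{1..N}. (z i)\<^sup>2) \<le> 16 * int N" by linarith
  have "z i \<in> {- 4 * int N..4 * int N}" if "i \<in> {1..N}" for i
  proof -
    have "(z i)\<^sup>2 \<le> (\<Sum>i\<in>{1..N}. (z i)\<^sup>2)" using that by (intro member_le_sum) auto
    also have "\<dots> \<le> 16 * int N * int N" using sum_sq' assms by (smt (verit) mult_le_cancel_left1 of_nat_0_less_iff)
    finally have "\<bar>z i\<bar>\<^sup>2 \<le> (4 * int N)\<^sup>2" by (simp add: power2_eq_square)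
    then have "\<bar>z i\<bar> \<le> 4 * int N" by (rule power2_le_imp_le) simp
    then show ?thesis by auto
  qed
  then have "z \<in> integer_net N" using sum_sq' by (auto simp: integer_net_def z_def)
  moreover have "L2_set (\<lambda>i. u i - grid_vector N z i) {1..N} \<le> 1 / 4"
  proof -
    have "\<bar>u i - grid_vector N z i\<bar> \<le> 1 / c" if "i \<in> {1..N}" for i
    proof -
      have "grid_vector N z i = of_int (trunc (c * u i)) / c"
        using that by (simp add: grid_vector_def z_def c_def)
      then have "u i - grid_vector N z i = (c * u i - of_int (trunc (c * u i))) / c"
        using c by (simp add: diff_divide_distrib)
      then show ?thesis using trunc_diff[of "c * u i"] c by (simp add: abs_divide divide_right_mono)
    qed
    then have "(u i - grid_vector N z i)\<^sup>2 \<le> (1 / c)\<^sup>2" if "i \<in> {1..N}" for i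
      using that c by (metis abs_ge_zero power2_abs power_mono)
    then have "(\<Sum>i\<in>{1..N}. (u i - grid_vector N z i)\<^sup>2) \<le> (\<Sum>i\<in>{1..N}. (1 / c)\<^sup>2)" by (rule sum_mono)
    also have "\<dots> = (1 / 4)\<^sup>2" using assms c by (simp add: power_divide power2_eq_square[of "1/4"])
    finally have "L2_set (\<lambda>i. u i - grid_vector N z i) {1..N} \<le> sqrt ((1 / 4)\<^sup>2)"
      unfolding L2_set_def by (rule real_sqrt_le_mono)
    then show ?thesis by simp
  qed
  ultimately show ?thesis by blast
qed

text \<open>Approximating both arguments of the bilinear form leaves two errors, each at most a
  quarter of the norm \<open>B\<close>, so \<open>B \<le> K + B / 2\<close>. With pairs of net
  vectors, \<open>M\<close> can be any real matrix.\<close>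

lemma spectral_norm_le_net:
  assumes N: "0 < N"
    and K: "\<And>z z'. z \<in> integer_net N \<Longrightarrow> z' \<in> integer_net N \<Longrightarrow>
      \<bar>\<Sum>i\<in>{1..N}. \<Sum>j\<in>{1..N}. grid_vector N z i * grid_vector N z' j * M i j\<bar> \<le> K"
  shows "spectral_norm N M \<le> 2 * K"
proof -
  let ?V = "{1..N}"
  define nm where "nm = (\<lambda>x::nat \<Rightarrow> real. L2_set x ?V)"
  define Mv where "Mv = (\<lambda>x i. \<Sum>j\<in>?V. M i j * x j)"
  define q where "q = (\<lambda>x y. \<Sum>i\<in>?V. x i * Mv y i)"
  define B where "B = spectral_norm N M"
  have B: "B = (SUP x\<in>{x. nm x \<le> 1}. nm (Mv x))"
    by (simp add: B_def spectral_norm_def nm_def Mv_def)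
  have entry: "\<bar>x j\<bar> \<le> nm x" if "j \<in> ?V" for x j
    using member_le_L2_set[of ?V j "\<lambda>i. \<bar>x i\<bar>"] that by (simp add: nm_def L2_set_def)
  \<comment> \<open>A real supremum is known to be an upper bound only for a bounded set; the
    absorption of \<open>B / 2\<close> at the end rests on this.\<close>
  have bdd: "bdd_above ((\<lambda>x. nm (Mv x)) ` {x. nm x \<le> 1})"
  proof (rule bdd_aboveI2)
    fix x assume "x \<in> {x. nm x \<le> 1}"
    then have x: "\<bar>x j\<bar> \<le> 1" if "j \<in> ?V" for j using entry[OF that, of x] by simp
    have "nm (Mv x) \<le> (\<Sum>i\<in>?V. \<bar>Mv x i\<bar>)" unfolding nm_def by (rule L2_set_le_sum_abs)
    also have "\<dots> \<le> (\<Sum>i\<in>?V. \<Sum>j\<in>?V. \<bar>M i j\<bar>)"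
    proof (rule sum_mono)
      fix i
      have "\<bar>Mv x i\<bar> \<le> (\<Sum>j\<in>?V. \<bar>M i j * x j\<bar>)" unfolding Mv_def by (rule sum_abs)
      also have "\<dots> \<le> (\<Sum>j\<in>?V. \<bar>M i j\<bar>)"
        using x by (intro sum_mono) (simp add: abs_mult mult_left_le)
      finally show "\<bar>Mv x i\<bar> \<le> (\<Sum>j\<in>?V. \<bar>M i j\<bar>)" .
    qed
    finally show "nm (Mv x) \<le> (\<Sum>i\<in>?V. \<Sum>j\<in>?V. \<bar>M i j\<bar>)" .
  qed
  have B_upper: "nm (Mv x) \<le> B" if "nm x \<le> 1" for x
    unfolding B by (rule cSUP_upper[OF _ bdd]) (use that in simp)
  have Mv_scale: "Mv (\<lambda>j. c * x j) = (\<lambda>i. c * Mv x i)" for c x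
    by (simp add: Mv_def sum_distrib_left algebra_simps)
  have nm_scale: "0 \<le> c \<Longrightarrow> nm (\<lambda>i. c * x i) = c * nm x" for c x
    by (simp add: nm_def L2_set_right_distrib)
  have B_quarter: "nm (Mv d) \<le> B / 4" if "nm d \<le> 1 / 4" for d
    using B_upper[of "\<lambda>j. 4 * d j"] that by (simp add: Mv_scale nm_scale)
  have q_le: "\<bar>q x y\<bar> \<le> nm x * nm (Mv y)" for x y
  proof -
    have "\<bar>q x y\<bar> \<le> (\<Sum>i\<in>?V. \<bar>x i\<bar> * \<bar>Mv y i\<bar>)"
      unfolding q_def by (rule order_trans[OF sum_abs]) (simp add: abs_mult)
    also have "\<dots> \<le> nm x * nm (Mv y)" unfolding nm_def by (rule L2_set_mult_ineq)
    finally show ?thesis .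
  qed
  have nm_nonneg: "0 \<le> nm x" for x by (simp add: nm_def)
  have nm_le_1: "nm x \<le> 1 \<longleftrightarrow> (\<Sum>i\<in>?V. (x i)\<^sup>2) \<le> 1" for x by (simp add: nm_def L2_set_def)
  have q_bound: "\<bar>q u v\<bar> \<le> K + B / 2" if u: "nm u \<le> 1" and v: "nm v \<le> 1" for u v
  proof -
    obtain z where z: "z \<in> integer_net N" "nm (\<lambda>i. u i - grid_vector N z i) \<le> 1 / 4"
      using exists_grid_approximation[OF N, of u] u[unfolded nm_le_1] unfolding nm_def by blast
    obtain z' where z': "z' \<in> integer_net N" "nm (\<lambda>i. v i - grid_vector N z' i) \<le> 1 / 4"
      using exists_grid_approximation[OF N, of v] v[unfolded nm_le_1] unfolding nm_def by blast
    let ?u = "grid_vector N z" and ?v = "grid_vector N z'"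
    have g: "nm ?v \<le> 1" using grid_vector_norm[OF z'(1)] by (simp add: nm_le_1)
    have Mv_diff: "Mv (\<lambda>j. x j - y j) i = Mv x i - Mv y i" for x y i
      by (simp add: Mv_def sum_subtractf[symmetric] algebra_simps)
    have "q u v = q ?u ?v + q (\<lambda>i. u i - ?u i) ?v + q u (\<lambda>i. v i - ?v i)"
      by (simp add: q_def Mv_diff sum.distrib[symmetric] algebra_simps)
    moreover have "q ?u ?v = (\<Sum>i\<in>?V. \<Sum>j\<in>?V. ?u i * ?v j * M i j)"
      by (simp add: q_def Mv_def sum_distrib_left algebra_simps)
    then have "\<bar>q ?u ?v\<bar> \<le> K" using K z z' by simp
    moreover have "\<bar>q (\<lambda>i. u i - ?u i) ?v\<bar> \<le> 1 / 4 * B"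
      by (rule order_trans[OF q_le]) (use z g B_upper nm_nonneg in \<open>intro mult_mono; simp\<close>)
    moreover have "\<bar>q u (\<lambda>i. v i - ?v i)\<bar> \<le> 1 * (B / 4)"
      by (rule order_trans[OF q_le]) (use u z' B_quarter nm_nonneg in \<open>intro mult_mono; simp\<close>)
    ultimately show ?thesis by linarith
  qed
  have "nm (Mv v) \<le> K + B / 2" if v: "nm v \<le> 1" for v
  proof (cases "nm (Mv v) = 0")
    case True
    then show ?thesis using q_bound[OF v v] by linarith
  next
    case False
    then have pos: "0 < nm (Mv v)" using nm_nonneg[of "Mv v"] by linarith
    \<comment> \<open>The normalized image of \<open>v\<close> turns \<open>q u v\<close> into the
      norm of \<open>Mv v\<close>.\<close>
    define u where "u = (\<lambda>i. (1 / nm (Mv v)) * Mv v i)"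
    have "nm u \<le> 1" unfolding u_def using pos by (subst nm_scale) auto
    moreover have "q u v = (\<Sum>i\<in>?V. (Mv v i)\<^sup>2) / nm (Mv v)"
      by (simp add: q_def u_def power2_eq_square sum_divide_distrib)
    moreover have "(\<Sum>i\<in>?V. (Mv v i)\<^sup>2) = (nm (Mv v))\<^sup>2" by (simp add: nm_def L2_set_def sum_nonneg)
    ultimately show ?thesis using q_bound[of u v] v pos by (simp add: power2_eq_square)
  qed
  then have "B \<le> K + B / 2"
    unfolding B by (intro cSUP_least) (auto intro!: exI[of _ "\<lambda>_. 0"] simp: nm_def L2_set_def B[symmetric])
  then show ?thesis by (simp add: B_def)
qed


section \<open>Counting subsets\<close>

lemma card_supersets:
  assumes "finite V" "F \<subseteq> V" "card F \<le> l"
  shows "card {e. e \<subseteq> V \<and> card e = l \<and> F \<subseteq> e} = (card V - card F) choose (l - card F)"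
proof -
  have fin: "finite F" "finite (V - F)" using assms finite_subset by auto
  have "bij_betw (\<lambda>e. e - F) {e. e \<subseteq> V \<and> card e = l \<and> F \<subseteq> e} {d. d \<subseteq> V - F \<and> card d = l - card F}"
  proof (rule bij_betw_byWitness[where f' = "\<lambda>d. d \<union> F"])
    show "(\<lambda>e. e - F) ` {e. e \<subseteq> V \<and> card e = l \<and> F \<subseteq> e} \<subseteq> {d. d \<subseteq> V - F \<and> card d = l - card F}"
      using fin by (auto simp: card_Diff_subset)
    show "(\<lambda>d. d \<union> F) ` {d. d \<subseteq> V - F \<and> card d = l - card F} \<subseteq> {e. e \<subseteq> V \<and> card e = l \<and> F \<subseteq> e}"
    proof clarify
      fix d assume d: "d \<subseteq> V - F" "card d = l - card F"
      then have "finite d" "d \<inter> F = {}" using fin finite_subset by auto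
      then have "card (d \<union> F) = l" using fin d assms by (simp add: card_Un_disjoint)
      then show "d \<union> F \<subseteq> V \<and> card (d \<union> F) = l \<and> F \<subseteq> d \<union> F" using d assms by auto
    qed
  qed (use assms in auto)
  then have "card {e. e \<subseteq> V \<and> card e = l \<and> F \<subseteq> e} = card {d. d \<subseteq> V - F \<and> card d = l - card F}"
    by (rule bij_betw_same_card)
  also have "\<dots> = card (V - F) choose (l - card F)" by (rule n_subsets[OF fin(2)])
  finally show ?thesis using assms fin by (simp add: card_Diff_subset)
qed

text \<open>For \<open>l \<le> N\<close>, the two binomials differ by the factor
  \<open>(l - 1) / (N - 1)\<close>, and \<open>N * (l - 1) \<le> l * (N - 1)\<close>. This trades a
  count of hyperedges through a pair for a count through a vertex and is the source of the entry
  bound \<open>m * D / N\<close>.\<close>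

lemma binomial_minus_two_le:
  assumes "2 \<le> l" "2 \<le> N"
  shows "N * ((N - 2) choose (l - 2)) \<le> l * ((N - 1) choose (l - 1))"
proof (cases "l \<le> N")
  case True
  define n k where "n = N - 2" and "k = l - 2"
  then have nk: "N = Suc (Suc n)" "l = Suc (Suc k)" using assms by simp_all
  with True have kn: "k \<le> n" by simp
  have eq: "Suc n * (n choose k) = (Suc n choose Suc k) * Suc k" by (rule Suc_times_binomial_eq)
  have "Suc n * (Suc (Suc n) * (n choose k)) = Suc (Suc n) * (Suc n * (n choose k))"
    by (rule mult.left_commute)
  also have "\<dots> = Suc (Suc n) * Suc k * (Suc n choose Suc k)"
    unfolding eq by (simp only: mult_ac)
  also have "\<dots> \<le> Suc n * Suc (Suc k) * (Suc n choose Suc k)"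
    using kn by (intro mult_right_mono) auto
  finally have "Suc (Suc n) * (n choose k) \<le> Suc (Suc k) * (Suc n choose Suc k)"
    by (metis mult.assoc nat_mult_le_cancel1 zero_less_Suc)
  then show ?thesis by (simp add: nk)
qed (use assms in \<open>simp add: binomial_eq_0\<close>)

text \<open>The classical upper estimate for the logarithm of the number of \<open>k\<close>-subsets
  of an \<open>N\<close>-set.\<close>

definition entropy_exponent :: "nat \<Rightarrow> nat \<Rightarrow> real" where
  "entropy_exponent N k = real k * ln (exp 1 * real N / real k)"

text \<open>The function \<open>x * ln (e * N / x)\<close> has derivative \<open>ln (N / x)\<close>,
  nonnegative up to \<open>N\<close>. The finite version needs only \<open>ln u \<le> u - 1\<close>
  and the lower bound 1 for the logarithm at \<open>k\<close>.\<close>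

lemma entropy_exponent_mono:
  assumes "0 < s" "s \<le> k" "k \<le> N"
  shows "entropy_exponent N s \<le> entropy_exponent N k"
proof -
  have pos: "0 < real s" "0 < real k" "0 < real N" using assms by auto
  have one_le: "1 \<le> ln (exp 1 * real N / real k)"
  proof -
    have "ln (exp 1 * real N / real k) = 1 + ln (real N / real k)"
      using pos by (simp add: ln_mult ln_div)
    moreover have "0 \<le> ln (real N / real k)" using pos assms by (intro ln_ge_zero) simp
    ultimately show ?thesis by simp
  qed
  have "ln (exp 1 * real N / real s) = ln (exp 1 * real N / real k) + ln (real k / real s)"
    using pos by (simp add: ln_mult ln_div)
  also have "ln (real k / real s) \<le> real k / real s - 1" using pos by (intro ln_le_minus_one) simp
  finally have "entropy_exponent N s \<le> real s * (ln (exp 1 * real N / real k) + (real k / real s - 1))"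
    unfolding entropy_exponent_def by (intro mult_left_mono) auto
  also have "\<dots> = real s * ln (exp 1 * real N / real k) + (real k - real s) * 1"
    using pos by (simp add: field_simps)
  also have "\<dots> \<le> real s * ln (exp 1 * real N / real k) + (real k - real s) * ln (exp 1 * real N / real k)"
    using one_le assms by (intro add_left_mono mult_left_mono) auto
  also have "\<dots> = entropy_exponent N k" by (simp add: entropy_exponent_def algebra_simps)
  finally show ?thesis .
qed

text \<open>A single term of the binomial expansion of \<open>(1 + s / N)^N\<close>, which is at
  most \<open>exp s\<close>.\<close>

lemma binomial_le_exp_entropy:
  assumes "0 < s" "s \<le> N"
  shows "real (N choose s) \<le> exp (entropy_exponent N s)"
proof -
  define x where "x = real s / real N"
  have x: "0 < x" using assms by (simp add: x_def)
  have "real (N choose s) * x ^ s \<le> (\<Sum>k\<le>N. real (N choose k) * x ^ k)"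
    using assms x by (intro member_le_sum[of s "{..N}" "\<lambda>k. real (N choose k) * x ^ k"]) auto
  also have "\<dots> = (1 + x) ^ N" using binomial_ring[of x 1 N] by (simp add: add.commute)
  also have "\<dots> \<le> exp x ^ N" using x by (intro power_mono exp_ge_add_one_self) auto
  also have "\<dots> = exp (real s)" using assms by (simp add: exp_of_nat_mult[symmetric] x_def)
  finally have "real (N choose s) \<le> exp (real s) * (1 / x) ^ s" using x by (simp add: field_simps)
  also have "\<dots> = (exp 1 * real N / real s) ^ s"
    by (simp add: x_def exp_of_nat_mult[symmetric] power_mult_distrib power_divide)
  also have "\<dots> = exp (entropy_exponent N s)"
    using assms by (simp add: entropy_exponent_def exp_of_nat_mult)
  finally show ?thesis .
qed

text \<open>Of the factor 7, one unit pays for the number of sets of a given size; the other six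
  give \<open>N^(-6)\<close> for each of the \<open>N\<close> sizes. Two such sums multiply to
  \<open>N^(-10)\<close>.\<close>

lemma sum_exp_entropy_le:
  assumes "0 < N"
  shows "(\<Sum>S\<in>Pow {1..N} - {{}}. exp (- 7 * entropy_exponent N (card S))) \<le> real N powr (- 5)"
proof -
  have "(\<Sum>S\<in>Pow {1..N} - {{}}. exp (- 7 * entropy_exponent N (card S))) =
      (\<Sum>s\<in>{1..N}. \<Sum>S\<in>{S \<in> Pow {1..N} - {{}}. card S = s}. exp (- 7 * entropy_exponent N (card S)))"
  proof (rule sum.group[symmetric])
    show "card ` (Pow {1..N} - {{}}) \<subseteq> {1..N}"
    proof (rule image_subsetI)
      fix S assume "S \<in> Pow {1..N} - {{}}"
      then show "card S \<in> {1..N}"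
        using card_mono[of "{1..N}" S] finite_subset[of S "{1..N}"] by (simp add: Suc_le_eq card_gt_0_iff)
    qed
  qed auto
  also have "\<dots> \<le> (\<Sum>s\<in>{1..N}. real N powr (- 6))"
  proof (rule sum_mono)
    fix s assume s: "s \<in> {1..N}"
    have "{S \<in> Pow {1..N} - {{}}. card S = s} = {S. S \<subseteq> {1..N} \<and> card S = s}" using s by auto
    then have "(\<Sum>S\<in>{S \<in> Pow {1..N} - {{}}. card S = s}. exp (- 7 * entropy_exponent N (card S))) =
        real (N choose s) * exp (- 7 * entropy_exponent N s)"
      by (simp add: n_subsets)
    also have "\<dots> \<le> exp (entropy_exponent N s) * exp (- 7 * entropy_exponent N s)"
      using s by (intro mult_right_mono binomial_le_exp_entropy) auto
    also have "\<dots> = exp (- 6 * entropy_exponent N s)" by (simp add: exp_add[symmetric])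
    also have "\<dots> \<le> exp (- 6 * entropy_exponent N 1)" using s entropy_exponent_mono[of 1 s N] by simp
    also have "\<dots> \<le> exp (- 6 * ln (real N))"
      using assms by (simp add: entropy_exponent_def ln_mult)
    also have "\<dots> = real N powr (- 6)" using assms by (simp add: powr_def)
    finally show "(\<Sum>S\<in>{S \<in> Pow {1..N} - {{}}. card S = s}. exp (- 7 * entropy_exponent N (card S)))
       \<le> real N powr (- 6)" .
  qed
  also have "\<dots> = real N powr 1 * real N powr (- 6)" using assms by simp
  also have "\<dots> = real N powr (- 5)" by (subst powr_add[symmetric]) simp
  finally show ?thesis .
qed


section \<open>The random hypergraph\<close>

locale inhomogeneous_hypergraph =
  fixes L :: "nat set" and N :: nat and Q :: "nat \<Rightarrow> nat list \<Rightarrow> real"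
  assumes finite_L: "finite L" and L_nonempty: "L \<noteq> {}" and two_le_L: "\<And>l. l \<in> L \<Longrightarrow> 2 \<le> l"
    and N_pos: "0 < N"
    and tensors: "symmetric_prob_tensors L N Q"
begin

definition edges :: "nat set set" where
  "edges = (\<Union>l\<in>L. possible_edges N l)"

definition max_prob :: "nat \<Rightarrow> real" where
  "max_prob l = Max (Q l ` multi_indices N l)"

abbreviation "\<V> \<equiv> {1..N}"
abbreviation "p \<equiv> edge_prob Q"
abbreviation "m \<equiv> real (Max L)"
abbreviation "D \<equiv> D_max L N Q"
abbreviation "P \<equiv> ER_hypergraph L N Q"
abbreviation "EA \<equiv> expected_adjacency L N Q"

section \<open>Edge probabilities and expected degrees of vertices and pairs\<close>

lemma P_eq: "P = Pi_pmf edges False (\<lambda>e. bernoulli_pmf (p e))"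
  by (simp add: ER_hypergraph_def edges_def)

lemma finite_possible_edges: "finite (possible_edges N l)"
  by (rule finite_subset[of _ "Pow \<V>"]) (auto simp: possible_edges_def)

lemma finite_edges: "finite edges"
  using finite_L finite_possible_edges by (simp add: edges_def)

lemma edge_subset: "e \<in> edges \<Longrightarrow> e \<subseteq> \<V>"
  and card_edge_in: "e \<in> edges \<Longrightarrow> card e \<in> L"
  by (auto simp: edges_def possible_edges_def)

lemma finite_edge: "e \<in> edges \<Longrightarrow> finite e"
  using edge_subset finite_subset by blast

lemma card_edge_le: "e \<in> edges \<Longrightarrow> card e \<le> Max L"
  using card_edge_in finite_L by simp

lemma m_ge_2: "2 \<le> m"
proof -
  have "2 \<le> Max L" using finite_L L_nonempty two_le_L Max_in by blast
  then show ?thesis by simp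
qed

lemma finite_multi_indices: "finite (multi_indices N l)"
  using finite_lists_length_eq[of "\<V>" l] by (simp add: multi_indices_def conj_commute)

lemma tensor_bounds:
  assumes "l \<in> L" "xs \<in> multi_indices N l"
  shows "0 \<le> Q l xs" "Q l xs \<le> 1"
  using tensors assms unfolding symmetric_prob_tensors_def by blast+

lemma max_prob_nonneg:
  assumes "l \<in> L"
  shows "0 \<le> max_prob l"
proof -
  \<comment> \<open>A constant multi-index exists even if \<open>l\<close> exceeds \<open>N\<close>
    and there is no hyperedge of order \<open>l\<close>.\<close>
  have mem: "replicate l 1 \<in> multi_indices N l" using N_pos by (auto simp: multi_indices_def)
  then have "0 \<le> Q l (replicate l 1)" by (rule tensor_bounds(1)[OF assms])
  also have "\<dots> \<le> max_prob l" unfolding max_prob_def using mem finite_multi_indices by simp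
  finally show ?thesis .
qed

lemma edge_prob_bounds:
  assumes "e \<in> edges"
  shows "0 \<le> p e" "p e \<le> 1" "p e \<le> max_prob (card e)"
proof -
  have "sorted_list_of_set e \<in> multi_indices N (card e)"
    using edge_subset[OF assms] finite_edge[OF assms] by (auto simp: multi_indices_def)
  then show "0 \<le> p e" "p e \<le> 1" "p e \<le> max_prob (card e)"
    using tensor_bounds[OF card_edge_in[OF assms]] finite_multi_indices
    by (simp_all add: edge_prob_def max_prob_def)
qed

lemma D_nonneg: "0 \<le> D"
  using max_prob_nonneg by (auto simp: D_max_def max_prob_def[symmetric] intro!: sum_nonneg)

lemma sum_edges: "(\<Sum>e\<in>edges. f e) = (\<Sum>l\<in>L. \<Sum>e\<in>possible_edges N l. f e)"
  unfolding edges_def using finite_L finite_possible_edges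
  by (intro sum.UNION_disjoint) (auto simp: possible_edges_def)

text \<open>Applied to one vertex and to a pair; \<open>card F \<le> 2\<close> keeps
  \<open>l - card F\<close> a true difference for every order in \<open>L\<close>.\<close>

lemma sum_prob_supersets_le:
  assumes "F \<subseteq> \<V>" "card F \<le> 2"
  shows "(\<Sum>e\<in>edges. p e * of_bool (F \<subseteq> e)) \<le> (\<Sum>l\<in>L. real ((N - card F) choose (l - card F)) * max_prob l)"
  unfolding sum_edges
proof (rule sum_mono)
  fix l assume l: "l \<in> L"
  have "(\<Sum>e\<in>possible_edges N l. p e * of_bool (F \<subseteq> e)) \<le> (\<Sum>e\<in>possible_edges N l. max_prob l * of_bool (F \<subseteq> e))"
  proof (intro sum_mono mult_right_mono)
    fix e assume e: "e \<in> possible_edges N l"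
    then have "e \<in> edges" "card e = l" using l by (auto simp: edges_def possible_edges_def)
    then show "p e \<le> max_prob l" using edge_prob_bounds(3) by blast
  qed auto
  also have "\<dots> = max_prob l * real (card {e \<in> possible_edges N l. F \<subseteq> e})"
    by (simp add: sum_distrib_left[symmetric] finite_possible_edges Int_def)
  also have "{e \<in> possible_edges N l. F \<subseteq> e} = {e. e \<subseteq> \<V> \<and> card e = l \<and> F \<subseteq> e}"
    by (auto simp: possible_edges_def)
  also have "card \<dots> = (N - card F) choose (l - card F)"
    using card_supersets[of "\<V>" F l] assms two_le_L[OF l] by simp
  finally show "(\<Sum>e\<in>possible_edges N l. p e * of_bool (F \<subseteq> e)) \<le> real ((N - card F) choose (l - card F)) * max_prob l"
    by (simp add: mult.commute)
qed

lemma sum_prob_vertex_le: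
  assumes "v \<in> \<V>"
  shows "(\<Sum>e\<in>edges. p e * of_bool (v \<in> e)) \<le> D"
  using sum_prob_supersets_le[of "{v}"] assms by (simp add: D_max_def max_prob_def)

lemma sum_prob_pair_le:
  assumes "i \<in> \<V>" "j \<in> \<V>" "i \<noteq> j"
  shows "(\<Sum>e\<in>edges. p e * of_bool (i \<in> e \<and> j \<in> e)) \<le> m * D / real N"
proof -
  have N2: "2 \<le> N" using assms by auto
  have "(\<Sum>e\<in>edges. p e * of_bool (i \<in> e \<and> j \<in> e)) \<le> (\<Sum>l\<in>L. real ((N - 2) choose (l - 2)) * max_prob l)"
    using sum_prob_supersets_le[of "{i, j}"] assms by (simp add: numeral_2_eq_2)
  also have "\<dots> \<le> (\<Sum>l\<in>L. m / real N * (real ((N - 1) choose (l - 1)) * max_prob l))"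
  proof (rule sum_mono)
    fix l assume l: "l \<in> L"
    have "real (N * ((N - 2) choose (l - 2))) \<le> real (l * ((N - 1) choose (l - 1)))"
      using binomial_minus_two_le[OF two_le_L[OF l] N2] by (rule of_nat_mono)
    also have "\<dots> \<le> m * real ((N - 1) choose (l - 1))"
      using finite_L l by (simp add: mult_right_mono)
    finally have "real ((N - 2) choose (l - 2)) \<le> m / real N * real ((N - 1) choose (l - 1))"
      using N_pos by (simp add: field_simps)
    then show "real ((N - 2) choose (l - 2)) * max_prob l \<le> m / real N * (real ((N - 1) choose (l - 1)) * max_prob l)"
      using max_prob_nonneg[OF l] by (metis mult.assoc mult_right_mono)
  qed
  also have "\<dots> = m * D / real N"
    unfolding sum_distrib_left[symmetric] by (simp add: D_max_def max_prob_def)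
  finally show ?thesis .
qed

section \<open>The adjacency matrix as a linear function of the hyperedge indicators\<close>

lemma adjacency_eq:
  "adjacency L N H i j = (\<Sum>e\<in>edges. of_bool (i \<noteq> j \<and> i \<in> e \<and> j \<in> e) * of_bool (H e))"
proof -
  have "(\<Sum>e\<in>{e \<in> possible_edges N l. {i, j} \<subseteq> e}. of_bool (H e)) =
      (\<Sum>e\<in>possible_edges N l. of_bool (i \<in> e \<and> j \<in> e) * of_bool (H e) :: real)" for l
    using finite_possible_edges by (intro sum.mono_neutral_cong_left) auto
  then show ?thesis by (simp add: adjacency_def sum_edges del: sum_of_bool_mult_eq sum_mult_of_bool_eq)
qed

lemma degree_eq: "real (degree L N H v) = (\<Sum>e\<in>edges. of_bool (v \<in> e) * of_bool (H e))"
proof -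
  have "{e \<in> \<Union> (possible_edges N ` L). H e \<and> v \<in> e} = edges \<inter> {e. v \<in> e \<and> H e}"
    by (auto simp: edges_def)
  then show ?thesis
    using finite_edges by (simp add: degree_def of_bool_conj[symmetric] del: sum_of_bool_mult_eq sum_mult_of_bool_eq)
qed

lemma integrable_P: "integrable (measure_pmf P) (f :: _ \<Rightarrow> real)"
  unfolding P_eq by (intro integrable_measure_pmf_finite finite_set_pmf_Pi_bernoulli finite_edges)

lemma expectation_linear:
  "measure_pmf.expectation P (\<lambda>H. \<Sum>e\<in>edges. c e * of_bool (H e)) = (\<Sum>e\<in>edges. c e * p e)"
proof -
  have "measure_pmf.expectation P (\<lambda>H. \<Sum>e\<in>edges. c e * of_bool (H e)) =
      (\<Sum>e\<in>edges. measure_pmf.expectation P (\<lambda>H. c e * of_bool (H e)))"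
    by (rule Bochner_Integration.integral_sum) (rule integrable_P)
  also have "\<dots> = (\<Sum>e\<in>edges. c e * p e)"
    unfolding P_eq using edge_prob_bounds finite_edges
    by (intro sum.cong) (simp_all add: bernoulli_expectation)
  finally show ?thesis .
qed

lemma expected_adjacency_eq:
  "EA i j = (\<Sum>e\<in>edges. of_bool (i \<noteq> j \<and> i \<in> e \<and> j \<in> e) * p e)"
  unfolding expected_adjacency_def adjacency_eq by (rule expectation_linear)

lemma expected_adjacency_nonneg: "0 \<le> EA i j"
  unfolding expected_adjacency_eq using edge_prob_bounds by (intro sum_nonneg) auto

lemma expected_adjacency_le:
  assumes "i \<in> \<V>" "j \<in> \<V>"
  shows "EA i j \<le> m * D / real N"
proof (cases "i = j")
  case True
  then show ?thesis using D_nonneg by (simp add: expected_adjacency_eq)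
next
  case False
  then show ?thesis using sum_prob_pair_le[OF assms] by (simp add: expected_adjacency_eq mult.commute del: sum_of_bool_mult_eq sum_mult_of_bool_eq)
qed

lemma adjacency_nonneg: "0 \<le> adjacency L N H i j"
  unfolding adjacency_eq by (intro sum_nonneg) auto

lemma adjacency_sym: "adjacency L N H i j = adjacency L N H j i"
  unfolding adjacency_eq by (intro sum.cong) auto

text \<open>A present hyperedge through \<open>i\<close> adds at most its cardinality to the row.
  This turns degree bounds into the row bounds used for heavy pairs.\<close>

lemma adjacency_row_sum_le: "(\<Sum>j\<in>\<V>. adjacency L N H i j) \<le> m * real (degree L N H i)"
proof -
  have "(\<Sum>j\<in>\<V>. adjacency L N H i j) =
      (\<Sum>e\<in>edges. (\<Sum>j\<in>\<V>. of_bool (i \<noteq> j \<and> i \<in> e \<and> j \<in> e)) * of_bool (H e))"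
    unfolding adjacency_eq sum_distrib_right by (rule sum.swap)
  also have "\<dots> \<le> (\<Sum>e\<in>edges. m * (of_bool (i \<in> e) * of_bool (H e)))"
  proof (rule sum_mono)
    fix e assume e: "e \<in> edges"
    have "(\<Sum>j\<in>\<V>. of_bool (i \<noteq> j \<and> i \<in> e \<and> j \<in> e) :: real) \<le> (\<Sum>j\<in>\<V>. if j \<in> e then of_bool (i \<in> e) else 0)"
      by (rule sum_mono) auto
    also have "\<dots> = (\<Sum>j\<in>e. of_bool (i \<in> e))"
      using edge_subset[OF e] by (simp add: sum.inter_restrict[symmetric] Int_absorb1)
    also have "\<dots> \<le> m * of_bool (i \<in> e)" using card_edge_le[OF e] by (simp add: mult_right_mono)
    finally show "(\<Sum>j\<in>\<V>. of_bool (i \<noteq> j \<and> i \<in> e \<and> j \<in> e)) * of_bool (H e) \<le> m * (of_bool (i \<in> e) * of_bool (H e))"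
      by (auto simp: mult_right_mono)
  qed
  also have "\<dots> = m * real (degree L N H i)" by (simp only: degree_eq sum_distrib_left)
  finally show ?thesis .
qed

subsection \<open>Linear functionals of the adjacency matrix\<close>

text \<open>The coefficient of the indicator of \<open>e\<close> after a linear functional of the
  matrix is regrouped by hyperedges, which makes it a sum of independent terms.\<close>

definition edge_weight :: "(nat \<Rightarrow> nat \<Rightarrow> real) \<Rightarrow> nat set \<Rightarrow> real" where
  "edge_weight F e = (\<Sum>i\<in>\<V>. \<Sum>j\<in>\<V>. F i j * of_bool (i \<noteq> j \<and> i \<in> e \<and> j \<in> e))"

lemma sum_edge_weight:
  "(\<Sum>i\<in>\<V>. \<Sum>j\<in>\<V>. F i j * (\<Sum>e\<in>edges. of_bool (i \<noteq> j \<and> i \<in> e \<and> j \<in> e) * h e)) =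
   (\<Sum>e\<in>edges. edge_weight F e * h e)"
proof -
  have "(\<Sum>i\<in>\<V>. \<Sum>j\<in>\<V>. F i j * (\<Sum>e\<in>edges. of_bool (i \<noteq> j \<and> i \<in> e \<and> j \<in> e) * h e)) =
     (\<Sum>i\<in>\<V>. \<Sum>j\<in>\<V>. \<Sum>e\<in>edges. F i j * of_bool (i \<noteq> j \<and> i \<in> e \<and> j \<in> e) * h e)"
    by (simp only: sum_distrib_left mult.assoc)
  also have "\<dots> = (\<Sum>i\<in>\<V>. \<Sum>e\<in>edges. \<Sum>j\<in>\<V>. F i j * of_bool (i \<noteq> j \<and> i \<in> e \<and> j \<in> e) * h e)"
    by (intro sum.cong refl sum.swap)
  also have "\<dots> = (\<Sum>e\<in>edges. \<Sum>i\<in>\<V>. \<Sum>j\<in>\<V>. F i j * of_bool (i \<noteq> j \<and> i \<in> e \<and> j \<in> e) * h e)"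
    by (rule sum.swap)
  finally show ?thesis by (simp only: edge_weight_def sum_distrib_right)
qed

lemma sum_adjacency_weight:
  "(\<Sum>i\<in>\<V>. \<Sum>j\<in>\<V>. F i j * adjacency L N H i j) = (\<Sum>e\<in>edges. edge_weight F e * of_bool (H e))"
  unfolding adjacency_eq by (rule sum_edge_weight)

lemma sum_expected_adjacency_weight:
  "(\<Sum>i\<in>\<V>. \<Sum>j\<in>\<V>. F i j * EA i j) = (\<Sum>e\<in>edges. edge_weight F e * p e)"
  unfolding expected_adjacency_eq by (rule sum_edge_weight)

lemma edge_weight_eq:
  assumes "e \<in> edges"
  shows "edge_weight F e = (\<Sum>(i,j)\<in>e \<times> e. F i j * of_bool (i \<noteq> j))"
proof -
  have "edge_weight F e = (\<Sum>i\<in>e. \<Sum>j\<in>e. F i j * of_bool (i \<noteq> j))"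
    unfolding edge_weight_def
  proof (rule sum.mono_neutral_cong_right)
    show "(\<Sum>j\<in>\<V>. F i j * of_bool (i \<noteq> j \<and> i \<in> e \<and> j \<in> e)) = (\<Sum>j\<in>e. F i j * of_bool (i \<noteq> j))"
      if "i \<in> e" for i
      using that edge_subset[OF assms] by (intro sum.mono_neutral_cong_right) auto
  qed (use edge_subset[OF assms] in auto)
  then show ?thesis by (simp only: sum.cartesian_product)
qed

lemma card_edge_square_le: "e \<in> edges \<Longrightarrow> real (card (e \<times> e)) \<le> m\<^sup>2"
  using card_edge_le[of e] by (simp add: card_cartesian_product power2_eq_square mult_mono)

lemma abs_edge_weight_le:
  assumes e: "e \<in> edges" and K: "\<And>i j. \<bar>F i j\<bar> \<le> K"
  shows "\<bar>edge_weight F e\<bar> \<le> m\<^sup>2 * K"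
proof -
  have K0: "0 \<le> K" using K[of 0 0] by linarith
  have "\<bar>edge_weight F e\<bar> \<le> (\<Sum>(i,j)\<in>e \<times> e. \<bar>F i j * of_bool (i \<noteq> j)\<bar>)"
    unfolding edge_weight_eq[OF e] by (rule order_trans[OF sum_abs]) (simp add: case_prod_unfold)
  also have "\<dots> \<le> (\<Sum>(i,j)\<in>e \<times> e. K)"
    using K K0 by (intro sum_mono) auto
  also have "\<dots> = real (card (e \<times> e)) * K" by (simp add: case_prod_unfold)
  also have "\<dots> \<le> m\<^sup>2 * K" using card_edge_square_le[OF e] K0 by (rule mult_right_mono)
  finally show ?thesis .
qed

text \<open>Cauchy-Schwarz over the at most \<open>m^2\<close> ordered pairs in \<open>e\<close>. It
  controls the variance through \<open>EA\<close> alone, in spite of the correlations between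
  entries.\<close>

lemma edge_weight_square_le:
  assumes e: "e \<in> edges"
  shows "(edge_weight F e)\<^sup>2 \<le> m\<^sup>2 * edge_weight (\<lambda>i j. (F i j)\<^sup>2) e"
proof -
  have "(edge_weight F e)\<^sup>2 = (\<Sum>x\<in>e \<times> e. 1 * (case x of (i, j) \<Rightarrow> F i j * of_bool (i \<noteq> j)))\<^sup>2"
    unfolding edge_weight_eq[OF e] by simp
  also have "\<dots> \<le> (\<Sum>x\<in>e \<times> e. 1\<^sup>2) * (\<Sum>x\<in>e \<times> e. (case x of (i, j) \<Rightarrow> F i j * of_bool (i \<noteq> j))\<^sup>2)"
    by (rule Cauchy_Schwarz_ineq_sum)
  also have "(\<Sum>x\<in>e \<times> e. (case x of (i, j) \<Rightarrow> F i j * of_bool (i \<noteq> j))\<^sup>2) = edge_weight (\<lambda>i j. (F i j)\<^sup>2) e"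
    unfolding edge_weight_eq[OF e] by (intro sum.cong) auto
  also have "(\<Sum>x\<in>e \<times> e. 1\<^sup>2) = real (card (e \<times> e))" by simp
  also have "\<dots> * edge_weight (\<lambda>i j. (F i j)\<^sup>2) e \<le> m\<^sup>2 * edge_weight (\<lambda>i j. (F i j)\<^sup>2) e"
    using card_edge_square_le[OF e]
    by (rule mult_right_mono) (auto simp: edge_weight_def intro!: sum_nonneg)
  finally show ?thesis .
qed

lemma sum_expected_adjacency_le:
  assumes "\<And>i j. 0 \<le> F i j"
  shows "(\<Sum>i\<in>\<V>. \<Sum>j\<in>\<V>. F i j * EA i j) \<le> m * D / real N * (\<Sum>i\<in>\<V>. \<Sum>j\<in>\<V>. F i j)"
proof -
  have "(\<Sum>i\<in>\<V>. \<Sum>j\<in>\<V>. F i j * EA i j) \<le> (\<Sum>i\<in>\<V>. \<Sum>j\<in>\<V>. F i j * (m * D / real N))"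
    using assms by (intro sum_mono mult_left_mono expected_adjacency_le) auto
  also have "\<dots> = (\<Sum>i\<in>\<V>. \<Sum>j\<in>\<V>. F i j) * (m * D / real N)"
    by (simp only: sum_distrib_right)
  finally show ?thesis by (simp only: mult.commute)
qed

lemma chernoff:
  "measure_pmf.prob P {H. x \<le> (\<Sum>e\<in>edges. c e * of_bool (H e))} \<le> exp ((\<Sum>e\<in>edges. p e * (exp (c e) - 1)) - x)"
  unfolding P_eq using finite_edges edge_prob_bounds by (intro bernoulli_chernoff) auto

text \<open>The linear part of the exponent cancels against the mean. The quadratic part is at most
  \<open>\<theta>^2 * m^2\<close> times the \<open>EA\<close>-weighted sum of squares, and
  \<open>EA i j \<le> m * D / N\<close> supplies the third factor \<open>m\<close>. The condition on
  \<theta> keeps every hyperedge in the range where \<open>exp u \<le> 1 + u + u^2\<close>.\<close>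

lemma bernstein:
  assumes \<theta>: "0 \<le> \<theta>" "\<theta> * (m\<^sup>2 * K) \<le> 1" and K: "\<And>i j. \<bar>F i j\<bar> \<le> K"
  shows "measure_pmf.prob P {H. \<tau> \<le> (\<Sum>i\<in>\<V>. \<Sum>j\<in>\<V>. F i j * (adjacency L N H i j - EA i j))}
     \<le> exp (\<theta>\<^sup>2 * (m ^ 3 * D / real N) * (\<Sum>i\<in>\<V>. \<Sum>j\<in>\<V>. (F i j)\<^sup>2) - \<theta> * \<tau>)"
proof -
  let ?Z = "edge_weight F"
  have "measure_pmf.prob P {H. \<tau> \<le> (\<Sum>i\<in>\<V>. \<Sum>j\<in>\<V>. F i j * (adjacency L N H i j - EA i j))} \<le>
      measure_pmf.prob P {H. \<theta> * \<tau> + (\<Sum>e\<in>edges. \<theta> * ?Z e * p e) \<le> (\<Sum>e\<in>edges. (\<theta> * ?Z e) * of_bool (H e))}"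
  proof (rule measure_pmf.finite_measure_mono)
    show "{H. \<tau> \<le> (\<Sum>i\<in>\<V>. \<Sum>j\<in>\<V>. F i j * (adjacency L N H i j - EA i j))} \<subseteq>
      {H. \<theta> * \<tau> + (\<Sum>e\<in>edges. \<theta> * ?Z e * p e) \<le> (\<Sum>e\<in>edges. (\<theta> * ?Z e) * of_bool (H e))}"
    proof clarify
      fix H assume "\<tau> \<le> (\<Sum>i\<in>\<V>. \<Sum>j\<in>\<V>. F i j * (adjacency L N H i j - EA i j))"
      also have "\<dots> = (\<Sum>e\<in>edges. ?Z e * of_bool (H e)) - (\<Sum>e\<in>edges. ?Z e * p e)"
        unfolding sum_adjacency_weight[symmetric] sum_expected_adjacency_weight[symmetric]
        by (simp only: right_diff_distrib sum_subtractf)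
      finally have "\<theta> * \<tau> \<le> \<theta> * ((\<Sum>e\<in>edges. ?Z e * of_bool (H e)) - (\<Sum>e\<in>edges. ?Z e * p e))"
        by (rule mult_left_mono) (rule \<theta>)
      then show "\<theta> * \<tau> + (\<Sum>e\<in>edges. \<theta> * ?Z e * p e) \<le> (\<Sum>e\<in>edges. (\<theta> * ?Z e) * of_bool (H e))"
        by (simp only: right_diff_distrib sum_distrib_left mult.assoc)
    qed
  qed simp
  also have "\<dots> \<le> exp ((\<Sum>e\<in>edges. p e * (exp (\<theta> * ?Z e) - 1)) - (\<theta> * \<tau> + (\<Sum>e\<in>edges. \<theta> * ?Z e * p e)))"
    by (rule chernoff)
  also have "(\<Sum>e\<in>edges. p e * (exp (\<theta> * ?Z e) - 1)) \<le>
      (\<Sum>e\<in>edges. \<theta> * ?Z e * p e + \<theta>\<^sup>2 * m\<^sup>2 * (edge_weight (\<lambda>i j. (F i j)\<^sup>2) e * p e))"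
  proof (rule sum_mono)
    fix e assume e: "e \<in> edges"
    have "\<theta> * ?Z e \<le> \<theta> * (m\<^sup>2 * K)" using abs_edge_weight_le[OF e, of F K] K \<theta> by (intro mult_left_mono) auto
    then have "exp (\<theta> * ?Z e) \<le> 1 + \<theta> * ?Z e + (\<theta> * ?Z e)\<^sup>2"
      using \<theta> by (intro exp_le_one_plus_square) linarith
    also have "(\<theta> * ?Z e)\<^sup>2 \<le> \<theta>\<^sup>2 * (m\<^sup>2 * edge_weight (\<lambda>i j. (F i j)\<^sup>2) e)"
      unfolding power_mult_distrib using edge_weight_square_le[OF e] by (intro mult_left_mono) auto
    finally have "p e * (exp (\<theta> * ?Z e) - 1) \<le> p e * (\<theta> * ?Z e + \<theta>\<^sup>2 * (m\<^sup>2 * edge_weight (\<lambda>i j. (F i j)\<^sup>2) e))"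
      using edge_prob_bounds[OF e] by (intro mult_left_mono) auto
    then show "p e * (exp (\<theta> * ?Z e) - 1) \<le> \<theta> * ?Z e * p e + \<theta>\<^sup>2 * m\<^sup>2 * (edge_weight (\<lambda>i j. (F i j)\<^sup>2) e * p e)"
      by (simp only: distrib_left mult_ac)
  qed
  also have "\<dots> = (\<Sum>e\<in>edges. \<theta> * ?Z e * p e) + \<theta>\<^sup>2 * m\<^sup>2 * (\<Sum>i\<in>\<V>. \<Sum>j\<in>\<V>. (F i j)\<^sup>2 * EA i j)"
    by (simp only: sum.distrib sum_expected_adjacency_weight sum_distrib_left)
  also have "\<dots> \<le> (\<Sum>e\<in>edges. \<theta> * ?Z e * p e) +
      \<theta>\<^sup>2 * m\<^sup>2 * (m * D / real N * (\<Sum>i\<in>\<V>. \<Sum>j\<in>\<V>. (F i j)\<^sup>2))"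
    by (intro add_left_mono mult_left_mono sum_expected_adjacency_le) auto
  finally show ?thesis
    by (simp add: power3_eq_cube power2_eq_square mult_ac)
qed

subsection \<open>Light pairs\<close>

definition light :: "(nat \<Rightarrow> real) \<Rightarrow> (nat \<Rightarrow> real) \<Rightarrow> nat \<Rightarrow> nat \<Rightarrow> real" where
  "light x y i j = of_bool (\<bar>x i * y j\<bar> \<le> sqrt D / real N) * (x i * y j)"

lemma light_tail:
  assumes D: "0 < D" and x: "(\<Sum>i\<in>\<V>. (x i)\<^sup>2) \<le> 1" and y: "(\<Sum>i\<in>\<V>. (y i)\<^sup>2) \<le> 1"
    and F: "F = light x y \<or> F = (\<lambda>i j. - light x y i j)"
  shows "measure_pmf.prob P {H. 10 * m\<^sup>2 * sqrt D \<le> (\<Sum>i\<in>\<V>. \<Sum>j\<in>\<V>. F i j * (adjacency L N H i j - EA i j))}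
     \<le> exp (- (19 / 2) * real N)"
proof -
  \<comment> \<open>The largest value for which each edge contributes at most 1 to the exponent.\<close>
  define \<theta> where "\<theta> = real N / (m\<^sup>2 * sqrt D)"
  have m: "2 \<le> m" by (rule m_ge_2)
  have N: "0 < real N" using N_pos by simp
  have F_le: "\<bar>F i j\<bar> \<le> sqrt D / real N" for i j
    using F D N by (auto simp: light_def)
  have "(\<Sum>i\<in>\<V>. \<Sum>j\<in>\<V>. (F i j)\<^sup>2) \<le> (\<Sum>i\<in>\<V>. \<Sum>j\<in>\<V>. (x i)\<^sup>2 * (y j)\<^sup>2)"
    using F by (intro sum_mono) (auto simp: light_def power_mult_distrib)
  also have "\<dots> = (\<Sum>i\<in>\<V>. (x i)\<^sup>2) * (\<Sum>j\<in>\<V>. (y j)\<^sup>2)" by (simp only: sum_product)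
  also have "\<dots> \<le> 1 * 1" using x y by (intro mult_mono) (auto intro!: sum_nonneg)
  finally have F2: "(\<Sum>i\<in>\<V>. \<Sum>j\<in>\<V>. (F i j)\<^sup>2) \<le> 1" by simp
  have "measure_pmf.prob P {H. 10 * m\<^sup>2 * sqrt D \<le> (\<Sum>i\<in>\<V>. \<Sum>j\<in>\<V>. F i j * (adjacency L N H i j - EA i j))}
     \<le> exp (\<theta>\<^sup>2 * (m ^ 3 * D / real N) * (\<Sum>i\<in>\<V>. \<Sum>j\<in>\<V>. (F i j)\<^sup>2) - \<theta> * (10 * m\<^sup>2 * sqrt D))"
  proof (rule bernstein)
    show "\<theta> * (m\<^sup>2 * (sqrt D / real N)) \<le> 1" using D N m by (simp add: \<theta>_def)
  qed (use F_le D in \<open>auto simp: \<theta>_def\<close>)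
  also have "\<dots> \<le> exp (\<theta>\<^sup>2 * (m ^ 3 * D / real N) * 1 - \<theta> * (10 * m\<^sup>2 * sqrt D))"
    using F2 D N m unfolding exp_le_cancel_iff by (intro diff_right_mono mult_left_mono) auto
  also have "\<theta>\<^sup>2 * (m ^ 3 * D / real N) * 1 = real N / m"
  proof -
    have "\<theta>\<^sup>2 = (real N)\<^sup>2 / (m ^ 4 * D)" using D by (simp add: \<theta>_def power_divide power_mult_distrib)
    then show ?thesis using D N m by (simp add: power2_eq_square power3_eq_cube power4_eq_xxxx)
  qed
  also have "\<theta> * (10 * m\<^sup>2 * sqrt D) = 10 * real N" using D N m by (simp add: \<theta>_def)
  also have "real N / m \<le> real N / 2" using m N by (intro divide_left_mono) auto
  finally show ?thesis by simp
qed

definition light_deviation :: "(nat set \<Rightarrow> bool) \<Rightarrow> bool" where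
  "light_deviation H \<longleftrightarrow> (\<exists>z\<in>integer_net N. \<exists>z'\<in>integer_net N.
     10 * m\<^sup>2 * sqrt D \<le> \<bar>\<Sum>i\<in>\<V>. \<Sum>j\<in>\<V>. light (grid_vector N z) (grid_vector N z') i j *
       (adjacency L N H i j - EA i j)\<bar>)"

text \<open>The union runs over two net vectors and a sign, at most \<open>2 * 48^(2 * N)\<close>
  events, and \<open>48^2 = 2304\<close>.\<close>

lemma prob_light_deviation:
  assumes D: "0 < D"
  shows "measure_pmf.prob P {H. light_deviation H} \<le> 2 * (exp 1 / 2) powr (- real N)"
proof -
  define I where "I = integer_net N \<times> integer_net N \<times> {1, - 1 :: real}"
  define B where "B = (\<lambda>(z, z', \<sigma>). {H. 10 * m\<^sup>2 * sqrt D \<le>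
     (\<Sum>i\<in>\<V>. \<Sum>j\<in>\<V>. \<sigma> * light (grid_vector N z) (grid_vector N z') i j * (adjacency L N H i j - EA i j))})"
  have fin: "finite I" using finite_integer_net by (simp add: I_def)
  have "{H. light_deviation H} \<subseteq> (\<Union>x\<in>I. B x)"
  proof clarify
    fix H assume "light_deviation H"
    then obtain z z' where z: "z \<in> integer_net N" "z' \<in> integer_net N"
      and le: "10 * m\<^sup>2 * sqrt D \<le> \<bar>\<Sum>i\<in>\<V>. \<Sum>j\<in>\<V>. light (grid_vector N z) (grid_vector N z') i j *
       (adjacency L N H i j - EA i j)\<bar>" (is "_ \<le> \<bar>?S\<bar>") by (auto simp: light_deviation_def)
    have "H \<in> B (z, z', 1) \<or> H \<in> B (z, z', - 1)"
    proof (cases "0 \<le> ?S")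
      case True
      then show ?thesis using le by (simp add: B_def)
    next
      case False
      then have "10 * m\<^sup>2 * sqrt D \<le> - ?S" using le by linarith
      then show ?thesis by (simp add: B_def sum_negf)
    qed
    then show "H \<in> (\<Union>x\<in>I. B x)" using z by (auto simp: I_def)
  qed
  then have "measure_pmf.prob P {H. light_deviation H} \<le> measure_pmf.prob P (\<Union>x\<in>I. B x)"
    by (intro measure_pmf.finite_measure_mono) auto
  also have "\<dots> \<le> (\<Sum>x\<in>I. measure_pmf.prob P (B x))"
    by (rule measure_pmf.finite_measure_subadditive_finite[OF fin]) auto
  also have "\<dots> \<le> (\<Sum>x\<in>I. exp (- (19 / 2) * real N))"
  proof (rule sum_mono)
    fix x assume "x \<in> I"
    then obtain z z' \<sigma> where x: "x = (z, z', \<sigma>)" "z \<in> integer_net N" "z' \<in> integer_net N" "\<sigma> = 1 \<or> \<sigma> = - 1"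
      by (auto simp: I_def)
    show "measure_pmf.prob P (B x) \<le> exp (- (19 / 2) * real N)"
      unfolding x(1) B_def prod.case
      by (rule light_tail[OF D grid_vector_norm[OF x(2)] grid_vector_norm[OF x(3)]]) (use x(4) in auto)
  qed
  also have "\<dots> = 2 * (real (card (integer_net N)) * real (card (integer_net N))) * exp (- (19 / 2) * real N)"
    by (simp add: I_def card_cartesian_product)
  also have "\<dots> \<le> 2 * (48 ^ N * 48 ^ N) * exp (- (19 / 2) * real N)"
    using card_integer_net[of N] by (intro mult_right_mono mult_left_mono mult_mono) auto
  also have "\<dots> = 2 * (2304 * exp (- (19 / 2))) ^ N"
    by (simp add: power_mult_distrib[symmetric] exp_of_nat_mult[symmetric] mult.commute)
  also have "\<dots> \<le> 2 * (2 / exp 1) ^ N"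
  proof (intro mult_left_mono power_mono)
    \<comment> \<open>What is needed is \<open>2304 \<le> 2 * exp (17 / 2)\<close>; already
      \<open>2 * (5 / 2)^8\<close> exceeds 3000.\<close>
    have "5 / 2 \<le> exp (1 :: real)" using exp_lower_Taylor_quadratic[of "1 :: real"] by simp
    then have "(5 / 2) ^ 8 \<le> exp (1 :: real) ^ 8" by (intro power_mono) auto
    also have "\<dots> = exp 8" by (simp add: exp_of_nat_mult[symmetric])
    also have "\<dots> \<le> exp (17 / 2 :: real)" by simp
    finally have "2304 \<le> 2 * exp (17 / 2 :: real)" by (simp add: power_divide)
    then have "2304 * exp (- (19 / 2)) \<le> 2 * exp (17 / 2 :: real) * exp (- (19 / 2))"
      by (intro mult_right_mono) auto
    also have "\<dots> = 2 * exp (- 1)" by (simp add: exp_add[symmetric])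
    finally show "2304 * exp (- (19 / 2)) \<le> 2 / exp (1 :: real)" by (simp add: exp_minus field_simps)
  qed auto
  also have "(2 / exp 1) ^ N = (exp 1 / 2) powr (- real N)"
    by (simp add: powr_minus powr_realpow power_divide)
  finally show ?thesis .
qed

subsection \<open>Discrepancy\<close>

definition pair_edges :: "(nat set \<Rightarrow> bool) \<Rightarrow> nat set \<Rightarrow> nat set \<Rightarrow> real" where
  "pair_edges H S T = (\<Sum>i\<in>S. \<Sum>j\<in>T. adjacency L N H i j)"

text \<open>An upper bound for the expectation of \<open>pair_edges\<close>, from the bound
  \<open>m * D / N\<close> on each entry, rather than the expectation itself. Ordered pairs are
  counted, so \<open>S\<close> and \<open>T\<close> may overlap.\<close>

definition pair_mean :: "nat set \<Rightarrow> nat set \<Rightarrow> real" where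
  "pair_mean S T = m * real (card S) * real (card T) * D / real N"

text \<open>The rate is \<open>ln r / m^2\<close>, where \<open>r\<close> is the ratio of
  \<open>x\<close> to the mean bound. Weights lie between 0 and \<open>m^2\<close>, so convexity of
  \<open>exp\<close> gives the linear estimate \<open>t * (r - 1)\<close> for the normalized weight
  \<open>t\<close>. The surplus \<open>x / m^2\<close> becomes the factor \<open>exp 1\<close>
  inside the logarithm.\<close>

lemma pair_edges_upper_tail:
  assumes D: "0 < D" and ST: "S \<subseteq> \<V>" "T \<subseteq> \<V>" "S \<noteq> {}" "T \<noteq> {}" and x: "pair_mean S T < x"
  shows "measure_pmf.prob P {H. x \<le> pair_edges H S T}
     \<le> exp (- (x / m\<^sup>2 * ln (x / (exp 1 * pair_mean S T))))"
proof -
  let ?\<mu> = "pair_mean S T"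
  have m: "2 \<le> m" by (rule m_ge_2)
  have fin: "finite S" "finite T" using ST finite_subset by auto
  have \<mu>: "0 < ?\<mu>" using D N_pos m ST fin by (simp add: pair_mean_def card_gt_0_iff)
  define F where "F = (\<lambda>i j. of_bool (i \<in> S) * of_bool (j \<in> T) :: real)"
  define W where "W = edge_weight F"
  define r where "r = x / ?\<mu>"
  have r: "1 < r" using x \<mu> by (simp add: r_def)
  have lnr: "0 < ln r" using r by simp
  have F_sum: "(\<Sum>i\<in>\<V>. \<Sum>j\<in>\<V>. F i j * M i j) = (\<Sum>i\<in>S. \<Sum>j\<in>T. M i j)" for M
  proof -
    have "(\<Sum>j\<in>\<V>. F i j * M i j) = of_bool (i \<in> S) * (\<Sum>j\<in>T. M i j)" for i
    proof -
      have "(\<Sum>j\<in>\<V>. F i j * M i j) = (\<Sum>j\<in>T. of_bool (i \<in> S) * M i j)"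
        using ST by (intro sum.mono_neutral_cong_right) (auto simp: F_def)
      then show ?thesis by (simp only: sum_distrib_left)
    qed
    moreover have "(\<Sum>i\<in>\<V>. of_bool (i \<in> S) * (\<Sum>j\<in>T. M i j)) = (\<Sum>i\<in>S. \<Sum>j\<in>T. M i j)"
      using ST by (intro sum.mono_neutral_cong_right) auto
    ultimately show ?thesis by simp
  qed
  have X_eq: "pair_edges H S T = (\<Sum>e\<in>edges. W e * of_bool (H e))" for H
    unfolding pair_edges_def W_def sum_adjacency_weight[symmetric] F_sum ..
  have mean: "(\<Sum>e\<in>edges. W e * p e) \<le> ?\<mu>"
  proof -
    have "(\<Sum>e\<in>edges. W e * p e) \<le> m * D / real N * (\<Sum>i\<in>\<V>. \<Sum>j\<in>\<V>. F i j)"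
      unfolding W_def sum_expected_adjacency_weight[symmetric]
      by (rule sum_expected_adjacency_le) (simp add: F_def)
    also have "(\<Sum>i\<in>\<V>. \<Sum>j\<in>\<V>. F i j) = real (card S) * real (card T)"
      using F_sum[of "\<lambda>_ _. 1"] by simp
    finally show ?thesis by (simp add: pair_mean_def mult_ac)
  qed
  define c where "c = (\<lambda>e. W e / m\<^sup>2 * ln r)"
  have "{H. x \<le> pair_edges H S T} = {H. x / m\<^sup>2 * ln r \<le> (\<Sum>e\<in>edges. c e * of_bool (H e))}"
  proof -
    have "(\<Sum>e\<in>edges. c e * of_bool (H e)) = pair_edges H S T * (ln r / m\<^sup>2)" for H
      unfolding X_eq sum_distrib_right by (intro sum.cong) (auto simp: c_def)
    moreover have "x / m\<^sup>2 * ln r \<le> y * (ln r / m\<^sup>2) \<longleftrightarrow> x \<le> y" for y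
    proof -
      have "0 < ln r / m\<^sup>2" using lnr m by simp
      then have "x * (ln r / m\<^sup>2) \<le> y * (ln r / m\<^sup>2) \<longleftrightarrow> x \<le> y" by (rule mult_le_cancel_right_pos)
      then show ?thesis by simp
    qed
    ultimately show ?thesis by simp
  qed
  then have "measure_pmf.prob P {H. x \<le> pair_edges H S T} \<le>
      exp ((\<Sum>e\<in>edges. p e * (exp (c e) - 1)) - x / m\<^sup>2 * ln r)"
    using chernoff[of "x / m\<^sup>2 * ln r" c] by simp
  also have "(\<Sum>e\<in>edges. p e * (exp (c e) - 1)) \<le> (\<Sum>e\<in>edges. W e * p e) * ((r - 1) / m\<^sup>2)"
    unfolding sum_distrib_right
  proof (rule sum_mono)
    fix e assume e: "e \<in> edges"
    define t where "t = W e / m\<^sup>2"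
    have W: "0 \<le> W e" by (auto simp: W_def edge_weight_def F_def intro!: sum_nonneg)
    have "\<bar>W e\<bar> \<le> m\<^sup>2 * 1" unfolding W_def by (rule abs_edge_weight_le[OF e]) (simp add: F_def)
    then have t: "0 \<le> t" "t \<le> 1" using W m by (simp_all add: t_def)
    have "exp ((1 - t) *\<^sub>R 0 + t *\<^sub>R ln r) \<le> (1 - t) * exp 0 + t * exp (ln r)"
      by (rule convex_onD[OF exp_convex]) (use t in auto)
    moreover have "c e = t * ln r" by (simp add: c_def t_def)
    ultimately have "exp (c e) - 1 \<le> t * (r - 1)" using r by (simp add: algebra_simps)
    then have "p e * (exp (c e) - 1) \<le> p e * (t * (r - 1))"
      using edge_prob_bounds[OF e] by (intro mult_left_mono) auto
    then show "p e * (exp (c e) - 1) \<le> W e * p e * ((r - 1) / m\<^sup>2)"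
      by (simp add: t_def mult_ac)
  qed
  also have "\<dots> \<le> ?\<mu> * ((r - 1) / m\<^sup>2)" using mean r by (intro mult_right_mono) auto
  also have "\<dots> \<le> x / m\<^sup>2"
  proof -
    have "?\<mu> * (r - 1) \<le> x" using \<mu> by (simp add: r_def algebra_simps)
    then have "?\<mu> * (r - 1) / m\<^sup>2 \<le> x / m\<^sup>2" by (rule divide_right_mono) simp
    then show ?thesis by simp
  qed
  also have "x / m\<^sup>2 - x / m\<^sup>2 * ln r = - (x / m\<^sup>2 * ln (x / (exp 1 * ?\<mu>)))"
  proof -
    have eq: "ln (x / (exp 1 * ?\<mu>)) = ln r - 1" using x \<mu> by (simp add: r_def ln_div ln_mult)
    show ?thesis unfolding eq by (simp add: right_diff_distrib)
  qed
  finally show ?thesis by simp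
qed

text \<open>The negation is one inequality in place of the usual alternative that the count is small
  compared to the mean or to the entropy: a count of at most \<open>exp 1 * pair_mean\<close>, with
  \<open>pair_mean\<close> positive, makes the product nonpositive.\<close>

definition discrepancy :: "(nat set \<Rightarrow> bool) \<Rightarrow> nat set \<Rightarrow> nat set \<Rightarrow> bool" where
  "discrepancy H S T \<longleftrightarrow> 14 * m\<^sup>2 * entropy_exponent N (card T)
     < pair_edges H S T * ln (pair_edges H S T / (exp 1 * pair_mean S T))"

lemma entropy_exponent_nonneg:
  assumes "k \<le> N"
  shows "0 \<le> entropy_exponent N k"
proof (cases "k = 0")
  case False
  have "0 \<le> entropy_exponent N 1" using N_pos by (simp add: entropy_exponent_def ln_mult add_nonneg_nonneg)
  also have "\<dots> \<le> entropy_exponent N k" using False assms by (intro entropy_exponent_mono) auto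
  finally show ?thesis .
qed (simp add: entropy_exponent_def)

text \<open>The \<open>m^2\<close> in the threshold cancels the \<open>1 / m^2\<close> in the tail
  exponent. The factor 14 later provides 7 for each of the two sets.\<close>

lemma prob_discrepancy_pair:
  assumes D: "0 < D" and ST: "S \<subseteq> \<V>" "T \<subseteq> \<V>" "S \<noteq> {}" "T \<noteq> {}"
  shows "measure_pmf.prob P {H. discrepancy H S T} \<le> exp (- 14 * entropy_exponent N (card T))"
proof -
  let ?\<mu> = "pair_mean S T"
  let ?\<tau> = "14 * m\<^sup>2 * entropy_exponent N (card T)"
  have m: "2 \<le> m" by (rule m_ge_2)
  have fin: "finite S" "finite T" using ST finite_subset by auto
  have \<mu>: "0 < ?\<mu>" using D N_pos m ST fin by (simp add: pair_mean_def card_gt_0_iff)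
  have "card T \<le> N" using card_mono[OF _ ST(2)] by simp
  then have \<tau>: "0 \<le> ?\<tau>" using entropy_exponent_nonneg by simp
  define bad where "bad = (\<lambda>n::nat. ?\<tau> < real n * ln (real n / (exp 1 * ?\<mu>)))"
  \<comment> \<open>Integrality guarantees that a least bad value exists.\<close>
  have integer: "\<exists>n. pair_edges H S T = real n" for H
  proof
    show "pair_edges H S T = real (\<Sum>i\<in>S. \<Sum>j\<in>T. \<Sum>e\<in>edges. of_bool (i \<noteq> j \<and> i \<in> e \<and> j \<in> e) * of_bool (H e))"
      unfolding pair_edges_def adjacency_eq by (simp only: of_nat_sum of_nat_mult of_nat_of_bool)
  qed
  show ?thesis
  proof (cases "\<exists>n. bad n")
    case True
    \<comment> \<open>Passing to the least bad value turns the event into an upper tail event.\<close>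
    define n where "n = (LEAST n. bad n)"
    have n: "bad n" unfolding n_def using True by (rule LeastI_ex)
    \<comment> \<open>As the threshold is nonnegative, a bad value has a positive logarithm and so
      exceeds \<open>exp 1 * ?\<mu>\<close>; this makes the upper tail bound applicable.\<close>
    have "0 < ln (real n / (exp 1 * ?\<mu>))" and n0: "0 < real n"
      using n \<tau> unfolding bad_def by (smt (verit) of_nat_0_le_iff mult_nonneg_nonpos mult_eq_0_iff)+
    then have "1 < real n / (exp 1 * ?\<mu>)" using \<mu> by (subst (asm) ln_gt_zero_iff) auto
    then have "exp 1 * ?\<mu> < real n" using \<mu> by (simp add: field_simps)
    moreover have "1 * ?\<mu> \<le> exp 1 * ?\<mu>" using \<mu> by (intro mult_right_mono) auto
    ultimately have n\<mu>: "?\<mu> < real n" by simp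
    have "{H. discrepancy H S T} \<subseteq> {H. real n \<le> pair_edges H S T}"
    proof clarify
      fix H assume H: "discrepancy H S T"
      obtain k where k: "pair_edges H S T = real k" using integer by blast
      have "bad k" using H by (simp add: discrepancy_def k bad_def)
      then have "n \<le> k" unfolding n_def by (rule Least_le)
      then show "real n \<le> pair_edges H S T" by (simp add: k)
    qed
    then have "measure_pmf.prob P {H. discrepancy H S T} \<le> measure_pmf.prob P {H. real n \<le> pair_edges H S T}"
      by (intro measure_pmf.finite_measure_mono) auto
    also have "\<dots> \<le> exp (- (real n / m\<^sup>2 * ln (real n / (exp 1 * ?\<mu>))))"
      by (rule pair_edges_upper_tail[OF D ST n\<mu>])
    also have "\<dots> \<le> exp (- 14 * entropy_exponent N (card T))"
    proof -
      have "?\<tau> / m\<^sup>2 \<le> (real n * ln (real n / (exp 1 * ?\<mu>))) / m\<^sup>2"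
        using n unfolding bad_def by (intro divide_right_mono) auto
      moreover have "?\<tau> / m\<^sup>2 = 14 * entropy_exponent N (card T)" using m by simp
      ultimately show ?thesis by simp
    qed
    finally show ?thesis .
  next
    case False
    have "\<not> discrepancy H S T" for H
    proof -
      obtain k where k: "pair_edges H S T = real k" using integer by blast
      then show ?thesis using False by (simp add: discrepancy_def k bad_def)
    qed
    then show ?thesis by simp
  qed
qed

definition discrepant :: "(nat set \<Rightarrow> bool) \<Rightarrow> bool" where
  "discrepant H \<longleftrightarrow> (\<exists>S T. S \<subseteq> \<V> \<and> T \<subseteq> \<V> \<and> S \<noteq> {} \<and> T \<noteq> {} \<and> card S \<le> card T \<and> discrepancy H S T)"

lemma prob_discrepant:
  assumes D: "0 < D"
  shows "measure_pmf.prob P {H. discrepant H} \<le> real N powr (- 10)"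
proof -
  define I where "I = Pow \<V> - {{}}"
  define B where "B = (\<lambda>(S, T). {H. card S \<le> card T \<and> discrepancy H S T})"
  have fin: "finite I" by (simp add: I_def)
  have "{H. discrepant H} \<subseteq> (\<Union>x\<in>I \<times> I. B x)" by (auto simp: discrepant_def I_def B_def)
  then have "measure_pmf.prob P {H. discrepant H} \<le> measure_pmf.prob P (\<Union>x\<in>I \<times> I. B x)"
    by (intro measure_pmf.finite_measure_mono) auto
  also have "\<dots> \<le> (\<Sum>x\<in>I \<times> I. measure_pmf.prob P (B x))"
    by (rule measure_pmf.finite_measure_subadditive_finite) (use fin in auto)
  also have "\<dots> \<le> (\<Sum>(S, T)\<in>I \<times> I. exp (- 7 * entropy_exponent N (card S)) * exp (- 7 * entropy_exponent N (card T)))"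
  proof (rule sum_mono, clarify)
    fix S T assume "S \<in> I" "T \<in> I"
    then have ST: "S \<subseteq> \<V>" "T \<subseteq> \<V>" "S \<noteq> {}" "T \<noteq> {}" by (auto simp: I_def)
    show "measure_pmf.prob P (B (S, T)) \<le> exp (- 7 * entropy_exponent N (card S)) * exp (- 7 * entropy_exponent N (card T))"
    proof (cases "card S \<le> card T")
      case True
      have "0 < card S" using ST finite_subset by (auto simp: card_gt_0_iff)
      moreover have "card T \<le> N" using card_mono[OF _ ST(2)] by simp
      \<comment> \<open>The order of the sizes lets half of the exponent for \<open>T\<close> be
        charged to \<open>S\<close>, so that the double sum factors.\<close>
      ultimately have "entropy_exponent N (card S) \<le> entropy_exponent N (card T)"
        using True by (intro entropy_exponent_mono) auto
      then have "exp (- 14 * entropy_exponent N (card T)) \<le>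
          exp (- 7 * entropy_exponent N (card S)) * exp (- 7 * entropy_exponent N (card T))"
        by (simp add: exp_add[symmetric])
      then show ?thesis using prob_discrepancy_pair[OF D ST] True by (simp add: B_def)
    qed (simp add: B_def)
  qed
  also have "\<dots> = (\<Sum>S\<in>I. exp (- 7 * entropy_exponent N (card S))) * (\<Sum>S\<in>I. exp (- 7 * entropy_exponent N (card S)))"
    by (simp only: sum_product sum.cartesian_product)
  also have "\<dots> \<le> real N powr (- 5) * real N powr (- 5)"
    unfolding I_def using sum_exp_entropy_le[OF N_pos] by (intro mult_mono sum_nonneg) auto
  also have "\<dots> = real N powr (- 10)" by (simp add: powr_add[symmetric])
  finally show ?thesis .
qed

subsection \<open>Regular outcomes\<close>

text \<open>With \<open>exp (5 / 2) \<le> 49 / 4\<close> and \<open>m \<ge> 2\<close>, the left side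
  is at most \<open>3700 * m^2 + 2 * m\<close>. From the last summand of \<open>beta0\<close> and
  \<open>sqrt m \<ge> 11 / 10\<close>, the right side is at least \<open>3952 * m^2 + 2 * m\<close>;
  bounding \<open>sqrt m\<close> below by 1 would fall just short in this estimate.\<close>

lemma conc_const_bound:
  "2 * (10 * m\<^sup>2 + m + 8 * (20 * m\<^sup>2 + 16 * exp (5 / 2) * m + 8 * (14 * m\<^sup>2))) \<le> conc_const L"
proof -
  have m: "2 \<le> m" by (rule m_ge_2)
  have "(exp (5 / 2 :: real))\<^sup>2 = exp 1 ^ 5" by (simp add: exp_of_nat_mult[symmetric])
  also have "\<dots> \<le> (272 / 100) ^ 5" using e_less_272 by (intro power_mono) auto
  also have "\<dots> \<le> (49 / 4 :: real)\<^sup>2" by (simp add: power_divide)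
  finally have e: "exp (5 / 2 :: real) \<le> 49 / 4" by (rule power2_le_imp_le) simp
  have "exp (5 / 2) * m \<le> 49 / 4 * m" using e m by (intro mult_right_mono) auto
  moreover have "2 * m \<le> m\<^sup>2" unfolding power2_eq_square using m by (intro mult_right_mono) auto
  moreover have "1792 * (11 / 10) * m\<^sup>2 \<le> beta0 L * sqrt m"
  proof -
    have "11 / 10 \<le> sqrt m" using m by (intro real_le_rsqrt) (simp add: power2_eq_square)
    moreover have b: "1792 * m\<^sup>2 \<le> beta0 L"
    proof -
      have "1792 * 1 * m\<^sup>2 \<le> 1792 * (1 + 1 / (exp 1)\<^sup>2) * m\<^sup>2"
        by (intro mult_right_mono mult_left_mono) auto
      moreover have "0 \<le> 32 * m * (1 + (exp 1)\<^sup>2)" by (intro mult_nonneg_nonneg add_nonneg_nonneg) auto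
      ultimately show ?thesis unfolding beta0_def by linarith
    qed
    moreover have "0 \<le> beta0 L" by (rule order_trans[OF _ b]) simp
    ultimately have "1792 * m\<^sup>2 * (11 / 10) \<le> beta0 L * sqrt m" by (intro mult_mono) auto
    then show ?thesis by (simp add: mult_ac)
  qed
  moreover have "conc_const L = 10 * m\<^sup>2 + 2 * (beta0 L * sqrt m + m)"
    by (simp add: conc_const_def beta_def beta1_def)
  ultimately show ?thesis by (simp add: algebra_simps)
qed

text \<open>In \<open>?K\<close>, the \<open>10 * m^2\<close> is the light part, \<open>m\<close>
  the expectation on heavy pairs and \<open>?h\<close> the adjacency on heavy pairs, with row bound
  \<open>20 * m^2 * D\<close> and \<kappa> equal to \<open>14 * m^2\<close>. The argument is
  deterministic, so \<open>J\<close> may depend on \<open>H\<close> in any way.\<close>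

lemma concentrates_of_regular:
  assumes D: "0 < D" and light_dev: "\<not> light_deviation H" and disc: "\<not> discrepant H"
    and J: "J \<subseteq> bounded_degree_vertices L N Q H"
  shows "concentrates L N Q H J"
proof -
  define G where "G = sqrt D"
  have G: "0 < G" "D = G\<^sup>2" using D by (simp_all add: G_def)
  have m: "2 \<le> m" by (rule m_ge_2)
  have N: "0 < real N" using N_pos by simp
  let ?A = "adjacency L N H"
  let ?h = "8 * (20 * m\<^sup>2 + 16 * exp (5 / 2) * m + 8 * (14 * m\<^sup>2))"
  let ?K = "(10 * m\<^sup>2 + m + ?h) * G"
  let ?M = "\<lambda>i j. restrict_matrix J ?A i j - restrict_matrix J EA i j"
  \<comment> \<open>Coordinates outside \<open>J\<close> become 0; \<open>undefined\<close> off the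
    vertex set keeps the function extensional, as membership in the net requires.\<close>
  define cut where "cut = (\<lambda>(z :: nat \<Rightarrow> int) i. if i \<in> \<V> then if i \<in> J then z i else 0 else undefined)"
  have cut_net: "cut z \<in> integer_net N" if "z \<in> integer_net N" for z
  proof -
    have "(\<Sum>i\<in>\<V>. (cut z i)\<^sup>2) \<le> (\<Sum>i\<in>\<V>. (z i)\<^sup>2)" by (rule sum_mono) (auto simp: cut_def)
    then have "(\<Sum>i\<in>\<V>. (cut z i)\<^sup>2) \<le> 16 * int N" using that by (simp add: integer_net_def)
    moreover have "cut z \<in> \<V> \<rightarrow>\<^sub>E {- 4 * int N..4 * int N}"
      using that by (auto simp: cut_def integer_net_def PiE_iff extensional_def)
    ultimately show ?thesis by (simp only: integer_net_def mem_Collect_eq simp_thms)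
  qed
  have cut_grid: "grid_vector N (cut z) i = of_bool (i \<in> J) * grid_vector N z i" if "i \<in> \<V>" for z i
    using that by (simp add: grid_vector_def cut_def)
  have "spectral_norm N ?M \<le> 2 * ?K"
  proof (rule spectral_norm_le_net[OF N_pos])
    fix z z' assume z: "z \<in> integer_net N" "z' \<in> integer_net N"
    define x where "x = grid_vector N (cut z)"
    define y where "y = grid_vector N (cut z')"
    have x: "(\<Sum>i\<in>\<V>. (x i)\<^sup>2) \<le> 1" unfolding x_def by (rule grid_vector_norm[OF cut_net[OF z(1)]])
    have y: "(\<Sum>i\<in>\<V>. (y i)\<^sup>2) \<le> 1" unfolding y_def by (rule grid_vector_norm[OF cut_net[OF z(2)]])
    define heavy where "heavy = (\<lambda>i j. of_bool (G / real N < \<bar>x i\<bar> * \<bar>y j\<bar>) * (\<bar>x i\<bar> * \<bar>y j\<bar>))"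
    have heavy_nonneg: "0 \<le> heavy i j" for i j by (simp add: heavy_def)
    have split: "(\<Sum>i\<in>\<V>. \<Sum>j\<in>\<V>. grid_vector N z i * grid_vector N z' j * ?M i j) =
        (\<Sum>i\<in>\<V>. \<Sum>j\<in>\<V>. light x y i j * (?A i j - EA i j)) +
        (\<Sum>i\<in>\<V>. \<Sum>j\<in>\<V>. (x i * y j - light x y i j) * (?A i j - EA i j))"
    proof -
      have "grid_vector N z i * grid_vector N z' j * ?M i j = x i * y j * (?A i j - EA i j)"
        if "i \<in> \<V>" "j \<in> \<V>" for i j
        unfolding x_def y_def cut_grid[OF that(1)] cut_grid[OF that(2)]
        by (auto simp: restrict_matrix_def right_diff_distrib)
      then have "(\<Sum>i\<in>\<V>. \<Sum>j\<in>\<V>. grid_vector N z i * grid_vector N z' j * ?M i j) =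
          (\<Sum>i\<in>\<V>. \<Sum>j\<in>\<V>. x i * y j * (?A i j - EA i j))"
        by (intro sum.cong refl)
      also have "\<dots> = (\<Sum>i\<in>\<V>. \<Sum>j\<in>\<V>. light x y i j * (?A i j - EA i j) +
          (x i * y j - light x y i j) * (?A i j - EA i j))"
        by (simp only: distrib_right[symmetric] add_diff_eq diff_add_cancel add_diff_cancel_left')
      finally show ?thesis by (simp only: sum.distrib)
    qed
    have light_part: "\<bar>\<Sum>i\<in>\<V>. \<Sum>j\<in>\<V>. light x y i j * (?A i j - EA i j)\<bar> \<le> 10 * m\<^sup>2 * G"
      using light_dev cut_net[OF z(1)] cut_net[OF z(2)]
      unfolding light_deviation_def x_def y_def G_def by (auto simp: not_le intro: less_imp_le)
    have heavy_part: "\<bar>\<Sum>i\<in>\<V>. \<Sum>j\<in>\<V>. (x i * y j - light x y i j) * (?A i j - EA i j)\<bar>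
        \<le> (\<Sum>i\<in>\<V>. \<Sum>j\<in>\<V>. heavy i j * ?A i j) + (\<Sum>i\<in>\<V>. \<Sum>j\<in>\<V>. heavy i j * EA i j)"
    proof -
      have "\<bar>\<Sum>i\<in>\<V>. \<Sum>j\<in>\<V>. (x i * y j - light x y i j) * (?A i j - EA i j)\<bar> \<le>
          (\<Sum>i\<in>\<V>. \<Sum>j\<in>\<V>. \<bar>(x i * y j - light x y i j) * (?A i j - EA i j)\<bar>)"
        by (intro order_trans[OF sum_abs] sum_mono sum_abs)
      also have "\<dots> \<le> (\<Sum>i\<in>\<V>. \<Sum>j\<in>\<V>. heavy i j * ?A i j + heavy i j * EA i j)"
      proof (intro sum_mono)
        fix i j
        have "\<bar>x i * y j - light x y i j\<bar> = heavy i j"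
          by (auto simp: light_def heavy_def G_def abs_mult)
        moreover have "\<bar>?A i j - EA i j\<bar> \<le> ?A i j + EA i j"
          using adjacency_nonneg[of H i j] expected_adjacency_nonneg[of i j] by linarith
        ultimately show "\<bar>(x i * y j - light x y i j) * (?A i j - EA i j)\<bar> \<le> heavy i j * ?A i j + heavy i j * EA i j"
          unfolding abs_mult distrib_left[symmetric] using heavy_nonneg by (simp add: mult_left_mono)
      qed
      finally show ?thesis by (simp only: sum.distrib)
    qed
    have "(\<Sum>i\<in>\<V>. \<Sum>j\<in>\<V>. of_bool (sqrt D / real (card \<V>) < \<bar>x i\<bar> * \<bar>y j\<bar>) * (\<bar>x i\<bar> * \<bar>y j\<bar> * ?A i j))
       \<le> 8 * (20 * m\<^sup>2 * D / sqrt D + sqrt D * (16 * exp (5 / 2) * m + 8 * (14 * m\<^sup>2)))"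
    proof (rule heavy_pairs_bound)
      fix i assume i: "i \<in> \<V>" and "0 < \<bar>x i\<bar> \<or> 0 < \<bar>y i\<bar>"
      then have "i \<in> J" by (auto simp: x_def y_def cut_grid)
      then have "real (degree L N H i) \<le> 20 * m * D" using J by (auto simp: bounded_degree_vertices_def)
      then have "m * real (degree L N H i) \<le> m * (20 * m * D)" by (rule mult_left_mono) simp
      then show "(\<Sum>j\<in>\<V>. ?A i j) \<le> 20 * m\<^sup>2 * D"
        using adjacency_row_sum_le[of H i] by (simp add: power2_eq_square mult_ac)
    next
      fix S T assume ST: "S \<subseteq> \<V>" "T \<subseteq> \<V>" "S \<noteq> {}" "T \<noteq> {}" "card S \<le> card T"
      then have "\<not> discrepancy H S T" using disc by (auto simp: discrepant_def)
      then show "(\<Sum>i\<in>S. \<Sum>j\<in>T. ?A i j) * ln ((\<Sum>i\<in>S. \<Sum>j\<in>T. ?A i j) /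
          (exp 1 * (m * real (card S) * real (card T) * D / real (card \<V>))))
        \<le> 14 * m\<^sup>2 * (real (card T) * ln (exp 1 * real (card \<V>) / real (card T)))"
        by (simp add: discrepancy_def pair_edges_def pair_mean_def entropy_exponent_def not_less)
    qed (use D m x y adjacency_nonneg adjacency_sym in auto)
    also have "20 * m\<^sup>2 * D / sqrt D = 20 * m\<^sup>2 * G"
      unfolding times_divide_eq_right[symmetric] G_def using D by (simp add: real_div_sqrt)
    also have "8 * (20 * m\<^sup>2 * G + sqrt D * (16 * exp (5 / 2) * m + 8 * (14 * m\<^sup>2))) = ?h * G"
      unfolding G_def[symmetric] by (simp add: algebra_simps)
    finally have heavy_A: "(\<Sum>i\<in>\<V>. \<Sum>j\<in>\<V>. heavy i j * ?A i j) \<le> ?h * G"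
      by (simp add: heavy_def G_def mult.assoc)
    have heavy_EA: "(\<Sum>i\<in>\<V>. \<Sum>j\<in>\<V>. heavy i j * EA i j) \<le> m * G"
    proof -
      \<comment> \<open>A heavy value \<open>t > G / N\<close> satisfies
        \<open>t \<le> t^2 * N / G\<close>, which replaces entries by their squares.\<close>
      have "(\<Sum>i\<in>\<V>. \<Sum>j\<in>\<V>. heavy i j) \<le> (\<Sum>i\<in>\<V>. \<Sum>j\<in>\<V>. (x i)\<^sup>2 * (y j)\<^sup>2 * (real N / G))"
      proof (intro sum_mono)
        fix i j
        show "heavy i j \<le> (x i)\<^sup>2 * (y j)\<^sup>2 * (real N / G)"
        proof (cases "G / real N < \<bar>x i\<bar> * \<bar>y j\<bar>")
          case True
          let ?t = "\<bar>x i\<bar> * \<bar>y j\<bar>"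
          have "1 \<le> ?t * (real N / G)" using True G N by (simp add: field_simps)
          then have "?t * 1 \<le> ?t * (?t * (real N / G))" by (rule mult_left_mono) simp
          moreover have "?t * ?t = (x i)\<^sup>2 * (y j)\<^sup>2"
            by (metis power2_eq_square power2_abs power_mult_distrib)
          ultimately show ?thesis using True by (simp add: heavy_def mult.assoc[symmetric])
        qed (use G in \<open>simp add: heavy_def\<close>)
      qed
      also have "\<dots> = (\<Sum>i\<in>\<V>. (x i)\<^sup>2) * (\<Sum>j\<in>\<V>. (y j)\<^sup>2) * (real N / G)"
        unfolding sum_product by (simp only: sum_distrib_right)
      also have "\<dots> \<le> 1 * 1 * (real N / G)"
        using x y G by (intro mult_right_mono mult_mono) (auto intro!: sum_nonneg)
      finally have le: "(\<Sum>i\<in>\<V>. \<Sum>j\<in>\<V>. heavy i j) \<le> real N / G" by simp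
      have "(\<Sum>i\<in>\<V>. \<Sum>j\<in>\<V>. heavy i j * EA i j) \<le> m * D / real N * (\<Sum>i\<in>\<V>. \<Sum>j\<in>\<V>. heavy i j)"
        by (rule sum_expected_adjacency_le[OF heavy_nonneg])
      also have "\<dots> \<le> m * D / real N * (real N / G)" using le D by (intro mult_left_mono) auto
      also have "\<dots> = m * (D / G)" using N by simp
      also have "D / G = G" using G(1) by (simp add: G(2) power2_eq_square)
      finally show ?thesis .
    qed
    show "\<bar>\<Sum>i\<in>\<V>. \<Sum>j\<in>\<V>. grid_vector N z i * grid_vector N z' j * ?M i j\<bar> \<le> ?K"
      unfolding split using light_part heavy_part heavy_A heavy_EA by (simp add: distrib_right)
  qed
  also have "\<dots> \<le> conc_const L * G"
    using mult_right_mono[OF conc_const_bound, of G] G by (simp add: mult.assoc)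
  finally show ?thesis by (simp add: concentrates_def G_def)
qed

text \<open>The retained vertices then have degree 0 and \<open>EA\<close> vanishes, so the matrix
  is zero. The general argument divides by \<open>sqrt D\<close>.\<close>

lemma concentrates_of_D_max_zero:
  assumes D: "D = 0" and J: "J \<subseteq> bounded_degree_vertices L N Q H"
  shows "concentrates L N Q H J"
proof -
  have zero: "restrict_matrix J (adjacency L N H) i j - restrict_matrix J EA i j = 0"
    if ij: "i \<in> \<V>" "j \<in> \<V>" for i j
  proof (cases "i \<in> J")
    case True
    then have "real (degree L N H i) \<le> 0" using J D by (auto simp: bounded_degree_vertices_def)
    then have "(\<Sum>j\<in>\<V>. adjacency L N H i j) \<le> 0" using adjacency_row_sum_le[of H i] by simp
    moreover have "adjacency L N H i j \<le> (\<Sum>j\<in>\<V>. adjacency L N H i j)"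
      using ij adjacency_nonneg by (intro member_le_sum) auto
    ultimately have "adjacency L N H i j = 0" using adjacency_nonneg[of H i j] by linarith
    moreover have "EA i j = 0"
      using expected_adjacency_le[OF ij] expected_adjacency_nonneg[of i j] D by simp
    ultimately show ?thesis by (simp add: restrict_matrix_def)
  qed (simp add: restrict_matrix_def)
  have "spectral_norm N (\<lambda>i j. restrict_matrix J (adjacency L N H) i j - restrict_matrix J EA i j) \<le> 2 * 0"
    by (rule spectral_norm_le_net[OF N_pos]) (simp add: zero)
  then show ?thesis by (simp add: concentrates_def D)
qed

text \<open>The conjunct \<open>0 < D\<close> makes the event empty for \<open>D = 0\<close>, where
  the bound holds deterministically.\<close>

definition irregular :: "(nat set \<Rightarrow> bool) \<Rightarrow> bool" where
  "irregular H \<longleftrightarrow> 0 < D \<and> (light_deviation H \<or> discrepant H)"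

lemma concentrates_of_not_irregular:
  assumes "\<not> irregular H" "J \<subseteq> bounded_degree_vertices L N Q H"
  shows "concentrates L N Q H J"
  using assms D_nonneg concentrates_of_regular concentrates_of_D_max_zero
  by (cases "D = 0") (auto simp: irregular_def)

lemma prob_irregular:
  "measure_pmf.prob P {H. irregular H} \<le> 2 * (exp 1 / 2) powr (- real N) + real N powr (- 10)"
proof (cases "0 < D")
  case True
  have "{H. irregular H} = {H. light_deviation H} \<union> {H. discrepant H}"
    using True by (auto simp: irregular_def)
  then have "measure_pmf.prob P {H. irregular H} \<le>
      measure_pmf.prob P {H. light_deviation H} + measure_pmf.prob P {H. discrepant H}"
    using measure_Un_le[of "{H. light_deviation H}" "measure_pmf P" "{H. discrepant H}"] by simp
  then show ?thesis using prob_light_deviation[OF True] prob_discrepant[OF True] by linarith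
qed (simp add: irregular_def)

lemma prob_ge_of_exceptional:
  assumes "\<And>H. \<not> B H \<Longrightarrow> G H"
  shows "1 - measure_pmf.prob P {H. B H} \<le> measure_pmf.prob P {H. G H}"
proof -
  have "1 - measure_pmf.prob P {H. B H} = measure_pmf.prob P (UNIV - {H. B H})"
    using measure_pmf.prob_compl[of "{H. B H}" P] by simp
  also have "\<dots> \<le> measure_pmf.prob P {H. G H}"
    by (rule measure_pmf.finite_measure_mono) (use assms in auto)
  finally show ?thesis .
qed

subsection \<open>Removing the vertices of largest degree\<close>

lemma max_expected_degree_le: "max_expected_degree L N Q \<le> D"
  unfolding max_expected_degree_def
proof (rule Max.boundedI)
  fix a assume "a \<in> (\<lambda>v. measure_pmf.expectation P (\<lambda>H. real (degree L N H v))) ` \<V>"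
  then obtain v where v: "v \<in> \<V>" "a = measure_pmf.expectation P (\<lambda>H. real (degree L N H v))" by blast
  then show "a \<le> D"
    using sum_prob_vertex_le[OF v(1)] unfolding degree_eq expectation_linear by (simp only: mult.commute)
qed (use N_pos in auto)

lemma average_degree_eq:
  "average_degree L N H = (\<Sum>e\<in>edges. real (card e) / real N * of_bool (H e))"
proof -
  have "(\<Sum>v\<in>\<V>. real (degree L N H v)) = (\<Sum>e\<in>edges. (\<Sum>v\<in>\<V>. of_bool (v \<in> e)) * of_bool (H e))"
    unfolding degree_eq sum_distrib_right by (rule sum.swap)
  also have "\<dots> = (\<Sum>e\<in>edges. real (card e) * of_bool (H e))"
  proof (rule sum.cong)
    fix e assume "e \<in> edges"
    then have "\<V> \<inter> {v. v \<in> e} = e" using edge_subset by blast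
    then show "(\<Sum>v\<in>\<V>. of_bool (v \<in> e)) * of_bool (H e) = real (card e) * of_bool (H e)" by simp
  qed simp
  finally show ?thesis
    by (simp only: average_degree_def sum_divide_distrib times_divide_eq_left)
qed

lemma sum_prob_card_le: "(\<Sum>e\<in>edges. p e * (real (card e) / real N)) \<le> D"
proof -
  have "(\<Sum>e\<in>edges. p e * real (card e)) = (\<Sum>e\<in>edges. \<Sum>v\<in>\<V>. p e * of_bool (v \<in> e))"
  proof (rule sum.cong)
    fix e assume "e \<in> edges"
    then have "\<V> \<inter> {v. v \<in> e} = e" using edge_subset by blast
    then show "p e * real (card e) = (\<Sum>v\<in>\<V>. p e * of_bool (v \<in> e))"
      unfolding sum_distrib_left[symmetric] by simp
  qed simp
  also have "\<dots> = (\<Sum>v\<in>\<V>. \<Sum>e\<in>edges. p e * of_bool (v \<in> e))" by (rule sum.swap)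
  also have "\<dots> \<le> (\<Sum>v\<in>\<V>. D)" by (rule sum_mono) (rule sum_prob_vertex_le)
  also have "\<dots> = real N * D" by simp
  finally show ?thesis
    unfolding times_divide_eq_right sum_divide_distrib[symmetric]
    using N_pos by (simp add: divide_le_eq mult.commute)
qed

text \<open>With coefficients \<open>c = card e / N \<le> 1\<close>,
  \<open>exp c - 1 \<le> 2 * c\<close>. The weighted sum is the average of the expected degrees, at
  most \<open>D\<close>, so the exponent is at most \<open>2 * D - 3 * D\<close>.\<close>

lemma prob_average_degree:
  assumes "Max L \<le> N"
  shows "measure_pmf.prob P {H. 3 * D \<le> average_degree L N H} \<le> exp (- D)"
proof -
  have "measure_pmf.prob P {H. 3 * D \<le> average_degree L N H} \<le>
      exp ((\<Sum>e\<in>edges. p e * (exp (real (card e) / real N) - 1)) - 3 * D)"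
    unfolding average_degree_eq by (rule chernoff)
  also have "(\<Sum>e\<in>edges. p e * (exp (real (card e) / real N) - 1)) \<le>
      (\<Sum>e\<in>edges. 2 * (p e * (real (card e) / real N)))"
  proof (rule sum_mono)
    fix e assume e: "e \<in> edges"
    let ?c = "real (card e) / real N"
    have c: "0 \<le> ?c" "?c \<le> 1" using card_edge_le[OF e] assms N_pos by simp_all
    have "exp ?c \<le> 1 + ?c + ?c\<^sup>2" by (rule exp_le_one_plus_square[OF c(2)])
    also have "?c\<^sup>2 \<le> ?c" using c by (simp only: power2_eq_square mult_left_le)
    finally have "p e * (exp ?c - 1) \<le> p e * (2 * ?c)"
      using edge_prob_bounds[OF e] by (intro mult_left_mono) auto
    then show "p e * (exp ?c - 1) \<le> 2 * (p e * ?c)" by (simp only: mult.left_commute)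
  qed
  also have "\<dots> \<le> 2 * D" unfolding sum_distrib_left[symmetric] using sum_prob_card_le by simp
  finally show ?thesis by simp
qed

text \<open>Rate 1 gives the exponent \<open>2 * D - 20 * m * D\<close>. Only \<open>- 4 * D\<close>
  is kept, enough to leave \<open>exp (- D)\<close> after Markov's inequality divides by
  \<open>exp (- 3 * D)\<close>.\<close>

lemma prob_high_degree:
  assumes "v \<in> \<V>"
  shows "measure_pmf.prob P {H. 20 * m * D < real (degree L N H v)} \<le> exp (- 4 * D)"
proof -
  have "measure_pmf.prob P {H. 20 * m * D < real (degree L N H v)} \<le>
      measure_pmf.prob P {H. 20 * m * D \<le> (\<Sum>e\<in>edges. of_bool (v \<in> e) * of_bool (H e))}"
    by (rule measure_pmf.finite_measure_mono) (auto simp only: degree_eq mem_Collect_eq subset_iff, simp)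
  also have "\<dots> \<le> exp ((\<Sum>e\<in>edges. p e * (exp (of_bool (v \<in> e)) - 1)) - 20 * m * D)"
    by (rule chernoff)
  also have "(\<Sum>e\<in>edges. p e * (exp (of_bool (v \<in> e)) - 1)) \<le> (\<Sum>e\<in>edges. 2 * (p e * of_bool (v \<in> e)))"
  proof (rule sum_mono)
    fix e assume e: "e \<in> edges"
    have "exp (1 :: real) \<le> 3" by (rule exp_le)
    then have "p e * (exp 1 - 1) \<le> p e * 2"
      using edge_prob_bounds[OF e] by (intro mult_left_mono) auto
    then show "p e * (exp (of_bool (v \<in> e)) - 1) \<le> 2 * (p e * of_bool (v \<in> e))" by simp
  qed
  also have "\<dots> \<le> 2 * D" unfolding sum_distrib_left[symmetric] using sum_prob_vertex_le[OF assms] by simp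
  also have "2 * D - 20 * m * D \<le> - 4 * D"
    using mult_right_mono[OF m_ge_2 D_nonneg] D_nonneg by simp
  finally show ?thesis by simp
qed

lemma prob_many_high_degrees:
  "measure_pmf.prob P {H. real N * exp (- 3 * D) \<le> real (card {v \<in> \<V>. 20 * m * D < real (degree L N H v)})}
   \<le> exp (- D)"
proof -
  let ?B = "\<lambda>v. {H. 20 * m * D < real (degree L N H v)}"
  let ?X = "\<lambda>H. \<Sum>v\<in>\<V>. indicator (?B v) H :: real"
  have card_eq: "real (card {v \<in> \<V>. 20 * m * D < real (degree L N H v)}) = ?X H" for H
    by (simp add: indicator_def sum.If_cases Int_def)
  have N: "0 < real N * exp (- 3 * D)" using N_pos by simp
  have "measure_pmf.prob P {H \<in> space (measure_pmf P). real N * exp (- 3 * D) \<le> ?X H}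
      \<le> measure_pmf.expectation P ?X / (real N * exp (- 3 * D))"
    by (rule integral_Markov_inequality_measure[OF integrable_P, of UNIV]) (use N in \<open>auto intro!: sum_nonneg\<close>)
  also have "measure_pmf.expectation P ?X = (\<Sum>v\<in>\<V>. measure_pmf.expectation P (indicator (?B v)))"
    by (rule Bochner_Integration.integral_sum) (rule integrable_P)
  also have "\<dots> = (\<Sum>v\<in>\<V>. measure_pmf.prob P (?B v))" by simp
  also have "\<dots> / (real N * exp (- 3 * D)) \<le> (\<Sum>v\<in>\<V>. exp (- 4 * D)) / (real N * exp (- 3 * D))"
    using N by (intro divide_right_mono sum_mono prob_high_degree) auto
  also have "(\<Sum>v\<in>\<V>. exp (- 4 * D)) / (real N * exp (- 3 * D)) = exp (- D)"
    using N_pos by (simp add: exp_diff[symmetric])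
  finally show ?thesis by (simp only: card_eq space_measure_pmf UNIV_I simp_thms)
qed

text \<open>A retained vertex of high degree would force high degree on all removed vertices, and
  together they would be too many.\<close>

lemma top_degree_removed_subset:
  assumes "top_degree_removed L N H J"
    and avg: "average_degree L N H < 3 * D"
    and few: "real (card {v \<in> \<V>. 20 * m * D < real (degree L N H v)}) < real N * exp (- 3 * D)"
  shows "J \<subseteq> bounded_degree_vertices L N Q H"
proof (rule ccontr)
  have J: "J \<subseteq> \<V>" "card (\<V> - J) = nat \<lfloor>real N * exp (- average_degree L N H)\<rfloor>"
      "\<And>u v. u \<in> \<V> - J \<Longrightarrow> v \<in> J \<Longrightarrow> degree L N H v \<le> degree L N H u"
    using assms(1) by (auto simp: top_degree_removed_def)
  assume "\<not> J \<subseteq> bounded_degree_vertices L N Q H"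
  then obtain v where v: "v \<in> J" "20 * m * D < real (degree L N H v)"
    using J(1) by (force simp: bounded_degree_vertices_def)
  have "20 * m * D < real (degree L N H u)" if "u \<in> \<V> - J" for u
    using v J(3)[OF that v(1)] by linarith
  then have sub: "insert v (\<V> - J) \<subseteq> {v \<in> \<V>. 20 * m * D < real (degree L N H v)}"
    using v J(1) by auto
  have "Suc (card (\<V> - J)) = card (insert v (\<V> - J))" using v by simp
  also have "\<dots> \<le> card {v \<in> \<V>. 20 * m * D < real (degree L N H v)}" by (rule card_mono[OF _ sub]) simp
  finally have "real (Suc (card (\<V> - J))) < real N * exp (- 3 * D)" using few by linarith
  moreover have "real N * exp (- 3 * D) \<le> real N * exp (- average_degree L N H)"
    using avg by (intro mult_left_mono) auto
  \<comment> \<open>The floor alone may fall below \<open>N * exp (- average_degree)\<close>;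
    counting the retained vertex \<open>v\<close> as well makes the inequality strict.\<close>
  moreover have "real N * exp (- average_degree L N H) < real (Suc (card (\<V> - J)))"
    unfolding J(2) using N_pos by simp linarith
  ultimately show False by linarith
qed

text \<open>The exceptional events do not mention \<open>J\<close>, so all ways of breaking ties are
  covered at once without further loss.\<close>

lemma prob_top_degree_removed:
  assumes "Max L \<le> N"
  shows "1 - (2 * (exp 1 / 2) powr (- real N) + real N powr (- 10) + 2 * exp (- D)) \<le>
    measure_pmf.prob P {H. \<forall>J. top_degree_removed L N H J \<longrightarrow> concentrates L N Q H J}"
proof -
  define B where "B = (\<lambda>H. 3 * D \<le> average_degree L N H)"
  define C where "C = (\<lambda>H. real N * exp (- 3 * D) \<le> real (card {v \<in> \<V>. 20 * m * D < real (degree L N H v)}))"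
  have "{H. irregular H \<or> B H \<or> C H} = {H. irregular H} \<union> ({H. B H} \<union> {H. C H})" by auto
  then have "measure_pmf.prob P {H. irregular H \<or> B H \<or> C H} \<le>
      measure_pmf.prob P {H. irregular H} + (measure_pmf.prob P {H. B H} + measure_pmf.prob P {H. C H})"
    using measure_Un_le[of "{H. irregular H}" "measure_pmf P" "{H. B H} \<union> {H. C H}"]
      measure_Un_le[of "{H. B H}" "measure_pmf P" "{H. C H}"] by simp
  also have "\<dots> \<le> 2 * (exp 1 / 2) powr (- real N) + real N powr (- 10) + 2 * exp (- D)"
    using prob_irregular prob_average_degree[OF assms] prob_many_high_degrees by (simp add: B_def C_def)
  finally have "1 - (2 * (exp 1 / 2) powr (- real N) + real N powr (- 10) + 2 * exp (- D)) \<le>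
      1 - measure_pmf.prob P {H. irregular H \<or> B H \<or> C H}" by simp
  also have "\<dots> \<le> measure_pmf.prob P {H. \<forall>J. top_degree_removed L N H J \<longrightarrow> concentrates L N Q H J}"
  proof (rule prob_ge_of_exceptional, intro allI impI)
    fix H J assume H: "\<not> (irregular H \<or> B H \<or> C H)" and J: "top_degree_removed L N H J"
    then have "J \<subseteq> bounded_degree_vertices L N Q H"
      by (intro top_degree_removed_subset) (auto simp: B_def C_def)
    then show "concentrates L N Q H J" using H by (intro concentrates_of_not_irregular) auto
  qed
  finally show ?thesis .
qed

end

section \<open>Choice of the exponent and assembly of both probability bounds\<close>

theorem mainTheorem9:
  fixes L :: "nat set"
  assumes "finite L" and "L \<noteq> {}" and "\<forall>l\<in>L. 2 \<le> l"
  shows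
    "(\<forall>c'>0. \<exists>c>0. \<forall>\<^sub>F N in sequentially. \<forall>Q.
        symmetric_prob_tensors L N Q \<and> max_expected_degree L N Q \<ge> c' * ln (real N) \<longrightarrow>
        measure_pmf.prob (ER_hypergraph L N Q)
            {H. \<forall>J. top_degree_removed L N H J \<longrightarrow> concentrates L N Q H J}
          \<ge> 1 - 2 * (exp 1 / 2) powr (- real N) - 2 * real N powr (- c))
     \<and>
     (\<forall>N\<ge>1. \<forall>Q. symmetric_prob_tensors L N Q \<longrightarrow>
        measure_pmf.prob (ER_hypergraph L N Q)
            {H. concentrates L N Q H (bounded_degree_vertices L N Q H)}
          \<ge> 1 - 2 * (exp 1 / 2) powr (- real N) - real N powr (- 10))"
proof (intro conjI allI impI)
  fix c' :: real assume c': "0 < c'"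
  \<comment> \<open>Both \<open>N^(-10)\<close> and \<open>exp (- D) \<le> N^(-c')\<close> are at
    most \<open>N^(-2 c)\<close>. Halving leaves a spare factor \<open>N^c \<ge> 2\<close>, which
    absorbs the coefficient in \<open>3 * N^(-2 c) \<le> 2 * N^(-c)\<close>. The threshold on
    \<open>N\<close> depends on \<open>c\<close> and \<open>L\<close> only, so it is uniform in
    \<open>Q\<close>.\<close>
  define c where "c = min c' 10 / 2"
  have c: "0 < c" "2 * c \<le> c'" "2 * c \<le> 10" using c' by (auto simp: c_def)
  have "\<forall>\<^sub>F N in sequentially. 2 \<le> real N powr c"
    using eventually_ge_at_top[of "nat \<lceil>2 powr (1 / c)\<rceil>"]
  proof eventually_elim
    case (elim N)
    then have "2 powr (1 / c) \<le> real N" by linarith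
    then have "(2 powr (1 / c)) powr c \<le> real N powr c" using c(1) by (intro powr_mono2) auto
    then show ?case using c(1) by (simp add: powr_powr)
  qed
  then have "\<forall>\<^sub>F N in sequentially. \<forall>Q.
        symmetric_prob_tensors L N Q \<and> max_expected_degree L N Q \<ge> c' * ln (real N) \<longrightarrow>
        measure_pmf.prob (ER_hypergraph L N Q)
            {H. \<forall>J. top_degree_removed L N H J \<longrightarrow> concentrates L N Q H J}
          \<ge> 1 - 2 * (exp 1 / 2) powr (- real N) - 2 * real N powr (- c)"
    using eventually_ge_at_top[of "Max L"] eventually_gt_at_top[of 0]
  proof eventually_elim
    case (elim N)
    show ?case
    proof (intro allI impI, elim conjE)
      fix Q assume Q: "symmetric_prob_tensors L N Q" "max_expected_degree L N Q \<ge> c' * ln (real N)"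
      interpret inhomogeneous_hypergraph L N Q
        by unfold_locales (use assms elim Q in auto)
      have N: "1 \<le> real N" using elim by simp
      \<comment> \<open>The growth hypothesis is transferred from the maximal expected degree to the
        larger quantity \<open>D_max\<close>.\<close>
      have D: "c' * ln (real N) \<le> D_max L N Q" using Q(2) max_expected_degree_le by linarith
      have "exp (- D_max L N Q) \<le> real N powr (- c')" using D N by (simp add: powr_def)
      also have "\<dots> \<le> real N powr (- (2 * c))" using N c by (intro powr_mono) auto
      finally have 1: "exp (- D_max L N Q) \<le> real N powr (- (2 * c))" .
      have 2: "real N powr (- 10) \<le> real N powr (- (2 * c))" using N c by (intro powr_mono) auto
      have 3: "real N powr (- (2 * c)) * 2 \<le> real N powr (- (2 * c)) * real N powr c"
        using elim by (intro mult_left_mono) auto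
      have "real N powr (- (2 * c)) * real N powr c = real N powr (- c)" by (simp add: powr_add[symmetric])
      with 1 2 3 have "real N powr (- 10) + 2 * exp (- D_max L N Q) \<le> 2 * real N powr (- c)"
        using powr_ge_zero[of "real N" "- (2 * c)"] by linarith
      then show "measure_pmf.prob (ER_hypergraph L N Q)
            {H. \<forall>J. top_degree_removed L N H J \<longrightarrow> concentrates L N Q H J}
          \<ge> 1 - 2 * (exp 1 / 2) powr (- real N) - 2 * real N powr (- c)"
        using prob_top_degree_removed elim by linarith
    qed
  qed
  with c(1) show "\<exists>c>0. \<forall>\<^sub>F N in sequentially. \<forall>Q.
        symmetric_prob_tensors L N Q \<and> max_expected_degree L N Q \<ge> c' * ln (real N) \<longrightarrow>
        measure_pmf.prob (ER_hypergraph L N Q)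
            {H. \<forall>J. top_degree_removed L N H J \<longrightarrow> concentrates L N Q H J}
          \<ge> 1 - 2 * (exp 1 / 2) powr (- real N) - 2 * real N powr (- c)" by blast
next
  fix N :: nat and Q assume N: "1 \<le> N" and Q: "symmetric_prob_tensors L N Q"
  interpret inhomogeneous_hypergraph L N Q
    by unfold_locales (use assms N Q in auto)
  \<comment> \<open>Here the retained set is the bounded-degree set itself, so
    \<open>irregular\<close> is the only exceptional event.\<close>
  have "1 - measure_pmf.prob (ER_hypergraph L N Q) {H. irregular H} \<le>
      measure_pmf.prob (ER_hypergraph L N Q) {H. concentrates L N Q H (bounded_degree_vertices L N Q H)}"
    by (rule prob_ge_of_exceptional) (rule concentrates_of_not_irregular, simp_all)
  then show "measure_pmf.prob (ER_hypergraph L N Q)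
            {H. concentrates L N Q H (bounded_degree_vertices L N Q H)}
          \<ge> 1 - 2 * (exp 1 / 2) powr (- real N) - real N powr (- 10)"
    using prob_irregular by linarith
qed

end
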